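(* Let $I=(0,1)$, $\mu>0$, $\gamma>1$, $\rho_0\in C(\bar I)$ with $\rho_0>0$ in $I$, $\rho_0=0$ on $\partial I$, and $u_0,e_0$ continuous with $e_0\ge0$, $e_0\not\equiv0$ in $I$. Suppose that there exist positive $\lambda_5,\lambda_6,\lambda_7,\lambda_8$ with $0<\lambda_7,\lambda_8<1$ such that either ($\frac{(\rho_0)_x}{\rho_0}+\frac{(e_0)_x}{\rho_0}\ge\lambda_5$ in $(0,\lambda_7)$, $u_0(\lambda_7)<0$, $u_0\le0$ in $(0,\lambda_7)$) or ($\frac{(\rho_0)_x}{\rho_0}+\frac{(e_0)_x}{\rho_0}\le-\lambda_6$ in $(\lambda_8,1)$, $u_0(\lambda_8)>0$, $u_0\ge0$ in $(\lambda_8,1)$). Then for every $T>0$ the problem $$\rho_t+(\rho u)_x=0,\quad (\rho u)_t+(\rho u^2+p)_x=\mu u_{xx},\quad (\rho e)_t+(\rho e u)_x+p u_x=\mu u_x^2\quad\text{in } I\times(0,T],$$ with $p=(\gamma-1)\rho e$, $(\rho,u,e)=(\rho_0,u_0,e_0)$ on $I\times\{t=0\}$ and $\rho=u=u_x=0$ on $\partial I\times(0,T]$, has no solution $(\rho,u,e)$ in $C^{2,1}(\bar I\times[0,T])$.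
   Context: $C^{2,1}(\bar I\times[0,T])$ denotes functions that are $C^2$ in $x$ and $C^1$ in $t$ on $\bar I\times[0,T]$. *)

theory Defs
  imports "HOL-Analysis.Analysis"
begin

definition C21 :: "real \<Rightarrow> (real \<Rightarrow> real \<Rightarrow> real) \<Rightarrow> (real \<Rightarrow> real \<Rightarrow> real)
    \<Rightarrow> (real \<Rightarrow> real \<Rightarrow> real) \<Rightarrow> (real \<Rightarrow> real \<Rightarrow> real) \<Rightarrow> bool" where
  "C21 T f fx fxx ft \<longleftrightarrow>
     continuous_on ({0..1} \<times> {0..T}) (\<lambda>(x,t). f x t) \<and>
     continuous_on ({0..1} \<times> {0..T}) (\<lambda>(x,t). fx x t) \<and>
     continuous_on ({0..1} \<times> {0..T}) (\<lambda>(x,t). fxx x t) \<and>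
     continuous_on ({0..1} \<times> {0..T}) (\<lambda>(x,t). ft x t) \<and>
     (\<forall>x\<in>{0..1}. \<forall>t\<in>{0..T}.
        ((\<lambda>y. f y t) has_real_derivative fx x t) (at x within {0..1}) \<and>
        ((\<lambda>y. fx y t) has_real_derivative fxx x t) (at x within {0..1}) \<and>
        ((\<lambda>s. f x s) has_real_derivative ft x t) (at t within {0..T}))"

end

theory Submission
  imports Defs
begin

text \<open>Let \<open>p = (\<gamma> - 1) \<rho> e\<close> and let \<open>F = \<mu> u\<^sub>x - p\<close> be the effective stress, so that
  \<open>F\<^sub>x = \<rho> (u\<^sub>t + u u\<^sub>x)\<close>. By reflection it suffices to treat the left end point, where
  \<open>F = 0\<close>. For a weight \<open>g = 1 - \<integral>\<^sub>0\<^sup>x \<rho> k dy\<close> the function \<open>Z = \<integral>\<^sub>0\<^sup>x g F dy\<close> solves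
  \<open>\<mu> Z\<^sub>x\<^sub>x = \<rho> (Z\<^sub>t + \<beta> Z\<^sub>x - R Z + \<integral>\<^sub>0\<^sup>x R\<^sub>x Z dy)\<close>
  with bounded \<open>\<beta>\<close> and \<open>R\<close>, and \<open>k\<close> can be chosen such that \<open>R\<^sub>x \<le> 0\<close> for a short time. With this sign the nonlocal
  term does not destroy the maximum principle and the Hopf lemma. The signs of \<open>u\<^sub>0\<close> and \<open>p\<close> give
  \<open>Z \<le> 0\<close> initially and \<open>Z < 0\<close> at \<open>\<lambda>\<^sub>7\<close>, so the Hopf lemma yields \<open>Z\<^sub>x < 0\<close> at \<open>x = 0\<close>,
  contradicting \<open>Z\<^sub>x = g F = 0\<close> there.\<close>

section \<open>A Hopf lemma for a nonlocal parabolic equation\<close>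

text \<open>A positive second derivative would make \<open>f'\<close> positive just to the right of
  \<open>x\<close>, and the mean value theorem would then lift \<open>f\<close> above its
  maximum.\<close>

lemma interior_max_second_deriv:
  fixes f f' :: "real \<Rightarrow> real"
  assumes x: "a < x" "x < b"
    and D: "\<And>y. a < y \<Longrightarrow> y < b \<Longrightarrow> (f has_real_derivative f' y) (at y)"
    and D2: "(f' has_real_derivative f2) (at x)"
    and max: "\<And>y. a < y \<Longrightarrow> y < b \<Longrightarrow> f y \<le> f x"
  shows "f' x = 0" "f2 \<le> 0"
proof -
  define d where "d = min (x - a) (b - x)"
  have d: "d > 0" using x by (simp add: d_def)
  show f0: "f' x = 0"
    by (rule DERIV_local_max[OF D[OF x] d]) (auto intro!: max simp: d_def abs_if split: if_splits)
  show "f2 \<le> 0"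
  proof (rule ccontr)
    assume "\<not> f2 \<le> 0"
    then obtain e where e: "e > 0" "\<And>h. h > 0 \<Longrightarrow> h < e \<Longrightarrow> f' x < f' (x + h)"
      using DERIV_pos_inc_right[OF D2] by force
    define h where "h = min e (b - x) / 2"
    have h: "h > 0" "h < e" "x + h < b"
      using e(1) x by (auto simp: h_def min_def field_simps)
    have "\<exists>z. x < z \<and> z < x + h \<and> f (x + h) - f x = (x + h - x) * f' z"
      by (rule MVT2) (use h x in \<open>auto intro!: D\<close>)
    then obtain z where z: "x < z" "z < x + h" "f (x + h) - f x = h * f' z" by auto
    have "f' z > 0" using e(2)[of "z - x"] z h f0 by auto
    then have "f (x + h) > f x" using z(3) h(1) by (smt (verit) mult_pos_pos)
    then show False using max[of "x + h"] h x by auto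
  qed
qed

text \<open>Common frame of the maximum principles below: by compactness a value above
  \<open>m\<close> forces a maximum off the parabolic boundary, possibly at the final time, and the
  equation at hand only has to refute it through \<open>nomax\<close>. Global maximality is handed
  on there because a nonlocal term sees the values at other points.\<close>

lemma parabolic_max_point:
  fixes Y Yx Yxx Yt :: "real \<Rightarrow> real \<Rightarrow> real"
  assumes pos: "0 < c" "0 < \<tau>"
    and cont: "continuous_on ({0..c} \<times> {0..\<tau>}) (\<lambda>z. Y (fst z) (snd z))"
    and Dx: "\<And>x t. 0 < x \<Longrightarrow> x < c \<Longrightarrow> 0 < t \<Longrightarrow> t \<le> \<tau> \<Longrightarrow>
      ((\<lambda>y. Y y t) has_real_derivative Yx x t) (at x)"
    and Dxx: "\<And>x t. 0 < x \<Longrightarrow> x < c \<Longrightarrow> 0 < t \<Longrightarrow> t \<le> \<tau> \<Longrightarrow>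
      ((\<lambda>y. Yx y t) has_real_derivative Yxx x t) (at x)"
    and Dt: "\<And>x t. 0 < x \<Longrightarrow> x < c \<Longrightarrow> 0 < t \<Longrightarrow> t \<le> \<tau> \<Longrightarrow>
      ((\<lambda>s. Y x s) has_real_derivative Yt x t) (at t within {0..\<tau>})"
    and bd: "\<And>t. t \<in> {0..\<tau>} \<Longrightarrow> Y 0 t \<le> m" "\<And>t. t \<in> {0..\<tau>} \<Longrightarrow> Y c t \<le> m"
      "\<And>x. x \<in> {0..c} \<Longrightarrow> Y x 0 \<le> m"
    and nomax: "\<And>x t. \<lbrakk>0 < x; x < c; 0 < t; t \<le> \<tau>; Y x t > m; Yx x t = 0; Yxx x t \<le> 0; Yt x t \<ge> 0;
      \<And>y s. y \<in> {0..c} \<Longrightarrow> s \<in> {0..\<tau>} \<Longrightarrow> Y y s \<le> Y x t\<rbrakk> \<Longrightarrow> False"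
    and xt: "x \<in> {0..c}" "t \<in> {0..\<tau>}"
  shows "Y x t \<le> m"
proof (rule ccontr)
  assume above: "\<not> Y x t \<le> m"
  have "\<exists>z\<in>{0..c} \<times> {0..\<tau>}. \<forall>w\<in>{0..c} \<times> {0..\<tau>}. Y (fst w) (snd w) \<le> Y (fst z) (snd z)"
    by (rule continuous_attains_sup[OF _ _ cont]) (use xt in \<open>auto intro: compact_Times\<close>)
  then obtain a b where ab: "a \<in> {0..c}" "b \<in> {0..\<tau>}"
    and mx: "\<And>y s. y \<in> {0..c} \<Longrightarrow> s \<in> {0..\<tau>} \<Longrightarrow> Y y s \<le> Y a b" by force
  have big: "Y a b > m" using mx[OF xt] above by auto
  have "a \<noteq> 0" "a \<noteq> c" "b \<noteq> 0" using big bd ab by fastforce+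
  then have a: "0 < a" "a < c" and b: "0 < b" "b \<le> \<tau>" using ab by auto
  have mxb: "Y y b \<le> Y a b" if "0 < y" "y < c" for y
    using mx[of y b] that ab by auto
  have 1: "Yx a b = 0" "Yxx a b \<le> 0"
    using interior_max_second_deriv[OF a, of "\<lambda>y. Y y b" "\<lambda>y. Yx y b", OF Dx[OF _ _ b] Dxx[OF a b] mxb]
    by auto
  \<comment> \<open>Since \<open>b = \<tau>\<close> is possible, only earlier times are compared: a
    negative derivative would give a larger value slightly before \<open>b\<close>.\<close>
  have 2: "Yt a b \<ge> 0"
  proof (rule ccontr)
    assume "\<not> Yt a b \<ge> 0"
    then obtain d where d: "d > 0" "\<And>h. h > 0 \<Longrightarrow> b - h \<in> {0..\<tau>} \<Longrightarrow> h < d \<Longrightarrow> Y a b < Y a (b - h)"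
      using has_real_derivative_neg_dec_left[OF Dt[OF a b]] by force
    define h where "h = min d b / 2"
    have "h > 0" "h < d" "h \<le> b" using d(1) b by (auto simp: h_def min_def field_simps)
    then show False using d(2)[of h] mx[of a "b - h"] ab by fastforce
  qed
  show False by (rule nomax[OF a b big 1 2 mx])
qed

lemma integral_ge_const:
  fixes f :: "real \<Rightarrow> real"
  assumes "0 \<le> x" "continuous_on {0..x} f" "\<And>y. y \<in> {0..x} \<Longrightarrow> f y \<ge> b"
  shows "integral {0..x} f \<ge> b * x"
proof -
  have "integral {0..x} (\<lambda>_. b) \<le> integral {0..x} f"
    by (rule integral_le) (use assms in \<open>auto intro: integrable_continuous_real\<close>)
  then show ?thesis using assms(1) by (simp add: mult.commute)
qed

text \<open>A weighted maximum principle first gives \<open>Z \<le> 0\<close>; a moving exponential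
  barrier then gives the linear decay at \<open>x = 0\<close>. Because \<open>S \<le> 0\<close>, the
  nonlocal term is controlled at a maximum in the first stage and nonnegative in the second. The
  strict convexity of the exponentials in \<open>x\<close> yields the contradiction even where
  \<open>\<rho>\<close> vanishes.\<close>

lemma nonlocal_hopf:
  fixes Z Zx Zxx Zt \<rho> \<beta> R S :: "real \<Rightarrow> real \<Rightarrow> real" and \<mu> C :: real
  assumes pos: "0 < c" "c \<le> 1" "0 < \<tau>" "0 < \<mu>"
    and cont: "continuous_on ({0..c} \<times> {0..\<tau>}) (\<lambda>z. Z (fst z) (snd z))"
    and Dx: "\<And>x t. 0 < x \<Longrightarrow> x < c \<Longrightarrow> 0 < t \<Longrightarrow> t \<le> \<tau> \<Longrightarrow>
      ((\<lambda>y. Z y t) has_real_derivative Zx x t) (at x)"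
    and Dxx: "\<And>x t. 0 < x \<Longrightarrow> x < c \<Longrightarrow> 0 < t \<Longrightarrow> t \<le> \<tau> \<Longrightarrow>
      ((\<lambda>y. Zx y t) has_real_derivative Zxx x t) (at x)"
    and Dt: "\<And>x t. 0 < x \<Longrightarrow> x < c \<Longrightarrow> 0 < t \<Longrightarrow> t \<le> \<tau> \<Longrightarrow>
      ((\<lambda>s. Z x s) has_real_derivative Zt x t) (at t within {0..\<tau>})"
    and eq: "\<And>x t. 0 < x \<Longrightarrow> x < c \<Longrightarrow> 0 < t \<Longrightarrow> t \<le> \<tau> \<Longrightarrow>
      \<mu> * Zxx x t = \<rho> x t * (Zt x t + \<beta> x t * Zx x t - R x t * Z x t
        + integral {0..x} (\<lambda>y. S y t * Z y t))"
    and rho: "\<And>x t. x \<in> {0..c} \<Longrightarrow> t \<in> {0..\<tau>} \<Longrightarrow> 0 \<le> \<rho> x t \<and> \<rho> x t \<le> C"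
    and coef: "\<And>x t. x \<in> {0..c} \<Longrightarrow> t \<in> {0..\<tau>} \<Longrightarrow> \<bar>\<beta> x t\<bar> \<le> C \<and> \<bar>R x t\<bar> \<le> C"
    and S: "\<And>x t. x \<in> {0..c} \<Longrightarrow> t \<in> {0..\<tau>} \<Longrightarrow> - C \<le> S x t \<and> S x t \<le> 0"
    and Scont: "\<And>t. t \<in> {0..\<tau>} \<Longrightarrow> continuous_on {0..c} (\<lambda>x. S x t)"
    and bd: "\<And>t. t \<in> {0..\<tau>} \<Longrightarrow> Z 0 t = 0" "\<And>t. t \<in> {0..\<tau>} \<Longrightarrow> Z c t < 0"
      "\<And>x. x \<in> {0..c} \<Longrightarrow> Z x 0 \<le> 0"
  shows "\<exists>\<epsilon>>0. \<forall>x\<in>{0..c}. Z x \<tau> \<le> - \<epsilon> * x"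
proof -
  have C0: "C \<ge> 0" using rho[of 0 0] pos by auto
  have SZ: "continuous_on {0..x} (\<lambda>y. S y t * Z y t)" if "x \<in> {0..c}" "t \<in> {0..\<tau>}" for x t
  proof -
    have "continuous_on {0..x} (\<lambda>y. Z y t)"
      by (rule continuous_on_compose2[OF cont, of _ "\<lambda>y. (y, t)", simplified])
        (use that in \<open>auto intro!: continuous_intros\<close>)
    then show ?thesis
      by (intro continuous_on_mult continuous_on_subset[OF Scont[OF that(2)]]) (use that in auto)
  qed
  have nonpos: "Z x t \<le> 0" if xt: "x \<in> {0..c}" "t \<in> {0..\<tau>}" for x t
  proof -
    \<comment> \<open>Chosen so that the curvature of \<open>exp (L * x)\<close> beats its
      contributions to the drift (\<open>C * L\<close>) and to the integral term (\<open>C\<close>),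
      both multiplied by \<open>\<rho> \<le> C\<close>.\<close>
    define L where "L = 1 + 2 * C\<^sup>2 / \<mu>"
    have L1: "L \<ge> 1" using pos by (simp add: L_def)
    have "\<mu> * L > 2 * C\<^sup>2" using pos by (simp add: L_def field_simps)
    then have "\<mu> * L * L > 2 * C\<^sup>2 * L" using L1 by (intro mult_strict_right_mono) auto
    moreover have "C\<^sup>2 * (L + 1) \<le> 2 * C\<^sup>2 * L" using L1 mult_left_mono[of 1 L "C\<^sup>2"] by (simp add: algebra_simps)
    ultimately have L: "\<mu> * L\<^sup>2 > C\<^sup>2 * (L + 1)" by (simp add: power2_eq_square mult.assoc)
    \<comment> \<open>At a maximum the time factor gives \<open>Zt \<ge> 2 * C * Z\<close>: one
      \<open>C\<close> absorbs \<open>R * Z\<close>, the other the integral term. Letting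
      \<open>\<epsilon>\<close> tend to 0 afterwards removes the perturbation.\<close>
    have small: "exp (- (2 * C * t)) * Z x t + \<epsilon> * exp (L * x) \<le> \<epsilon> * exp (L * c)"
      if eps: "\<epsilon> > 0" for \<epsilon>
    proof (rule parabolic_max_point[OF pos(1,3), where Y = "\<lambda>x t. exp (- (2 * C * t)) * Z x t + \<epsilon> * exp (L * x)"
          and Yx = "\<lambda>x t. exp (- (2 * C * t)) * Zx x t + \<epsilon> * (L * exp (L * x))"
          and Yxx = "\<lambda>x t. exp (- (2 * C * t)) * Zxx x t + \<epsilon> * (L * (L * exp (L * x)))"
          and Yt = "\<lambda>x t. exp (- (2 * C * t)) * Zt x t - 2 * C * exp (- (2 * C * t)) * Z x t",
          OF _ _ _ _ _ _ _ _ xt])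
      show "continuous_on ({0..c} \<times> {0..\<tau>})
          (\<lambda>z. exp (- (2 * C * snd z)) * Z (fst z) (snd z) + \<epsilon> * exp (L * fst z))"
        by (intro continuous_intros cont)
    next
      fix x t assume a: "0 < x" "x < c" "0 < t" "t \<le> \<tau>"
      show "((\<lambda>y. exp (- (2 * C * t)) * Z y t + \<epsilon> * exp (L * y)) has_real_derivative
          exp (- (2 * C * t)) * Zx x t + \<epsilon> * (L * exp (L * x))) (at x)"
        by (auto intro!: derivative_eq_intros Dx a)
      show "((\<lambda>y. exp (- (2 * C * t)) * Zx y t + \<epsilon> * (L * exp (L * y))) has_real_derivative
          exp (- (2 * C * t)) * Zxx x t + \<epsilon> * (L * (L * exp (L * x)))) (at x)"
        by (auto intro!: derivative_eq_intros Dxx a)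
      show "((\<lambda>s. exp (- (2 * C * s)) * Z x s + \<epsilon> * exp (L * x)) has_real_derivative
          exp (- (2 * C * t)) * Zt x t - 2 * C * exp (- (2 * C * t)) * Z x t) (at t within {0..\<tau>})"
        by (auto intro!: derivative_eq_intros Dt a)
    next
      fix t assume t: "t \<in> {0..\<tau>}"
      show "exp (- (2 * C * t)) * Z 0 t + \<epsilon> * exp (L * 0) \<le> \<epsilon> * exp (L * c)"
        using bd(1)[OF t] eps pos L1 by simp
      show "exp (- (2 * C * t)) * Z c t + \<epsilon> * exp (L * c) \<le> \<epsilon> * exp (L * c)"
        using bd(2)[OF t] by (simp add: mult_nonneg_nonpos)
    next
      fix x assume x: "x \<in> {0..c}"
      show "exp (- (2 * C * 0)) * Z x 0 + \<epsilon> * exp (L * x) \<le> \<epsilon> * exp (L * c)"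
      proof -
        have "\<epsilon> * exp (L * x) \<le> \<epsilon> * exp (L * c)" using x L1 eps by simp
        then show ?thesis using bd(3)[OF x] by simp
      qed
    next
      fix x t
      assume a: "0 < x" "x < c" "0 < t" "t \<le> \<tau>"
        and big: "\<epsilon> * exp (L * c) < exp (- (2 * C * t)) * Z x t + \<epsilon> * exp (L * x)"
        and Y1: "exp (- (2 * C * t)) * Zx x t + \<epsilon> * (L * exp (L * x)) = 0"
        and Y2: "exp (- (2 * C * t)) * Zxx x t + \<epsilon> * (L * (L * exp (L * x))) \<le> 0"
        and Y3: "0 \<le> exp (- (2 * C * t)) * Zt x t - 2 * C * exp (- (2 * C * t)) * Z x t"
        and mx: "\<And>y s. y \<in> {0..c} \<Longrightarrow> s \<in> {0..\<tau>} \<Longrightarrow>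
          exp (- (2 * C * s)) * Z y s + \<epsilon> * exp (L * y) \<le> exp (- (2 * C * t)) * Z x t + \<epsilon> * exp (L * x)"
      define E where "E = exp (- (2 * C * t))"
      define q where "q = \<epsilon> * exp (L * x)"
      define I where "I = integral {0..x} (\<lambda>y. S y t * Z y t)"
      have E: "E > 0" by (simp add: E_def)
      have q: "q > 0" using eps by (simp add: q_def)
      have xin: "x \<in> {0..c}" and tin: "t \<in> {0..\<tau>}" using a by auto
      have qc: "q \<le> \<epsilon> * exp (L * c)" using xin L1 eps by (simp add: q_def)
      have EZ: "E * Z x t > 0" using big qc by (simp add: E_def q_def)
      \<comment> \<open>Maximality bounds \<open>E * Z y t\<close> by \<open>E * Z x t + q\<close>;
        multiplying by \<open>S \<le> 0\<close> reverses this into a lower bound, and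
        \<open>x \<le> 1\<close> removes the length of the interval.\<close>
      have I: "E * I \<ge> - C * (E * Z x t + q)"
      proof -
        have "S y t * (E * Z y t) \<ge> - C * (E * Z x t + q)" if y: "y \<in> {0..x}" for y
        proof -
          have "E * Z y t + \<epsilon> * exp (L * y) \<le> E * Z x t + q"
            using mx[of y t] y xin tin by (auto simp: E_def q_def)
          then have "E * Z y t \<le> E * Z x t + q" using eps by (smt (verit) exp_gt_zero mult_pos_pos)
          then have "S y t * (E * Z y t) \<ge> S y t * (E * Z x t + q)"
            using S[of y t] y xin tin by (intro mult_left_mono_neg) auto
          moreover have "S y t * (E * Z x t + q) \<ge> - C * (E * Z x t + q)"
            using S[of y t] y xin tin EZ q by (intro mult_right_mono) auto
          ultimately show ?thesis by linarith
        qed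
        then have "integral {0..x} (\<lambda>y. E * (S y t * Z y t)) \<ge> - C * (E * Z x t + q) * x"
          by (intro integral_ge_const continuous_intros SZ[OF xin tin]) (use a in \<open>auto simp: mult.left_commute\<close>)
        moreover have "C * (E * Z x t + q) * x \<le> C * (E * Z x t + q) * 1"
          using a pos C0 EZ q by (intro mult_left_mono) auto
        ultimately show ?thesis by (simp add: I_def)
      qed
      have Zx: "E * Zx x t = - (L * q)" using Y1 by (simp add: E_def q_def algebra_simps)
      have b: "\<beta> x t * (E * Zx x t) \<ge> - C * (L * q)"
      proof -
        have "\<beta> x t * (L * q) \<le> C * (L * q)"
          using coef[OF xin tin] L1 q by (intro mult_right_mono) auto
        then show ?thesis by (simp add: Zx)
      qed
      have r: "R x t * (E * Z x t) \<le> C * (E * Z x t)"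
        using coef[OF xin tin] EZ by (intro mult_right_mono) auto
      have "\<mu> * (E * Zxx x t) = E * (\<mu> * Zxx x t)" by simp
      also have "\<dots> = \<rho> x t * (E * Zt x t + \<beta> x t * (E * Zx x t) - R x t * (E * Z x t) + E * I)"
        unfolding eq[OF a] I_def by (simp add: algebra_simps)
      also have "\<dots> \<ge> \<rho> x t * (- C * (L + 1) * q)"
      proof (rule mult_left_mono)
        have "E * Zt x t \<ge> 2 * C * (E * Z x t)" using Y3 by (simp add: E_def algebra_simps)
        then show "- C * (L + 1) * q \<le> E * Zt x t + \<beta> x t * (E * Zx x t) - R x t * (E * Z x t) + E * I"
          using b r I by (simp add: algebra_simps)
      qed (use rho[OF xin tin] in auto)
      finally have "\<mu> * (E * Zxx x t) \<ge> - (\<rho> x t * (C * (L + 1) * q))" by simp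
      moreover have "\<rho> x t * (C * (L + 1) * q) \<le> C * (C * (L + 1) * q)"
        using rho[OF xin tin] C0 L1 q by (intro mult_right_mono) auto
      moreover have "\<mu> * (E * Zxx x t) \<le> \<mu> * (- (L\<^sup>2 * q))"
        using Y2 pos by (intro mult_left_mono) (auto simp: E_def q_def power2_eq_square algebra_simps)
      ultimately have "\<mu> * L\<^sup>2 * q \<le> C\<^sup>2 * (L + 1) * q" by (simp add: power2_eq_square algebra_simps)
      then show False using L q by simp
    qed
    have "exp (- (2 * C * t)) * Z x t \<le> 0"
    proof (rule field_le_epsilon)
      fix d :: real assume d: "d > 0"
      have "exp (- (2 * C * t)) * Z x t + d / exp (L * c) * exp (L * x) \<le> d / exp (L * c) * exp (L * c)"
        using d by (intro small) auto
      moreover have "d / exp (L * c) * exp (L * x) > 0" using d by simp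
      moreover have "d / exp (L * c) * exp (L * c) = d" by simp
      ultimately show "exp (- (2 * C * t)) * Z x t \<le> 0 + d" by linarith
    qed
    then show ?thesis by (simp add: mult_le_0_iff)
  qed
  obtain \<eta> where eta: "\<eta> > 0" "\<And>t. t \<in> {0..\<tau>} \<Longrightarrow> Z c t \<le> - \<eta>"
  proof -
    have "continuous_on {0..\<tau>} (\<lambda>t. Z c t)"
      by (rule continuous_on_compose2[OF cont, of _ "\<lambda>t. (c, t)", simplified])
        (use pos in \<open>auto intro!: continuous_intros\<close>)
    then obtain s where "s \<in> {0..\<tau>}" "\<And>t. t \<in> {0..\<tau>} \<Longrightarrow> Z c t \<le> Z c s"
      using continuous_attains_sup[of "{0..\<tau>}" "\<lambda>t. Z c t"] pos by auto
    then show thesis using bd(2)[of s] by (intro that[of "- Z c s"]) auto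
  qed
  define V where "V = c / \<tau>"
  have V: "V > 0" using pos by (simp add: V_def)
  \<comment> \<open>Here the curvature has to dominate \<open>C\<close> times
    \<open>L * V + C * L + C\<close>, whose terms stem from the motion of the barrier, the drift and
    the zero-order term.\<close>
  define L where "L = 1 + C * (V + 2 * C) / \<mu>"
  have L1: "L \<ge> 1" using pos V C0 by (simp add: L_def)
  have "\<mu> * L > C * (V + 2 * C)" using pos by (simp add: L_def field_simps)
  then have "\<mu> * L * L > C * (V + 2 * C) * L" using L1 by (intro mult_strict_right_mono) auto
  moreover have "C * (L * V + C * L + C) \<le> C * (V + 2 * C) * L"
    using L1 C0 mult_left_mono[of 1 L "C\<^sup>2"] by (simp add: algebra_simps power2_eq_square)
  ultimately have L: "\<mu> * L\<^sup>2 > C * (L * V + C * L + C)" by (simp add: power2_eq_square mult.assoc)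
  \<comment> \<open>Normalised so that the barrier is at most \<open>\<eta>\<close> at
    \<open>x = c\<close>, where \<open>Z \<le> - \<eta>\<close>.\<close>
  define \<epsilon> where "\<epsilon> = \<eta> / exp (L * c)"
  have eps: "\<epsilon> > 0" using eta by (simp add: \<epsilon>_def)
  \<comment> \<open>The zero set of the barrier moves from \<open>x = c\<close> to \<open>x = 0\<close> as \<open>t\<close> runs through \<open>[0, \<tau>]\<close>.\<close>
  have barrier: "Z x t + \<epsilon> * (exp (L * x) - exp (L * (c - V * t))) \<le> 0"
    if xt: "x \<in> {0..c}" "t \<in> {0..\<tau>}" for x t
  proof (rule parabolic_max_point[OF pos(1,3), where Y = "\<lambda>x t. Z x t + \<epsilon> * (exp (L * x) - exp (L * (c - V * t)))"
        and Yx = "\<lambda>x t. Zx x t + \<epsilon> * (L * exp (L * x))"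
        and Yxx = "\<lambda>x t. Zxx x t + \<epsilon> * (L * (L * exp (L * x)))"
        and Yt = "\<lambda>x t. Zt x t + \<epsilon> * (L * V * exp (L * (c - V * t)))",
        OF _ _ _ _ _ _ _ _ xt])
    show "continuous_on ({0..c} \<times> {0..\<tau>})
        (\<lambda>z. Z (fst z) (snd z) + \<epsilon> * (exp (L * fst z) - exp (L * (c - V * snd z))))"
      by (intro continuous_intros cont)
  next
    fix x t assume a: "0 < x" "x < c" "0 < t" "t \<le> \<tau>"
    show "((\<lambda>y. Z y t + \<epsilon> * (exp (L * y) - exp (L * (c - V * t)))) has_real_derivative
        Zx x t + \<epsilon> * (L * exp (L * x))) (at x)"
      by (auto intro!: derivative_eq_intros Dx a)
    show "((\<lambda>y. Zx y t + \<epsilon> * (L * exp (L * y))) has_real_derivative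
        Zxx x t + \<epsilon> * (L * (L * exp (L * x)))) (at x)"
      by (auto intro!: derivative_eq_intros Dxx a)
    show "((\<lambda>s. Z x s + \<epsilon> * (exp (L * x) - exp (L * (c - V * s)))) has_real_derivative
        Zt x t + \<epsilon> * (L * V * exp (L * (c - V * t)))) (at t within {0..\<tau>})"
      by (auto intro!: derivative_eq_intros Dt a)
  next
    fix t assume t: "t \<in> {0..\<tau>}"
    have "V * t \<le> c" using t pos by (simp add: V_def field_simps)
    then have "exp (L * (c - V * t)) \<ge> 1" using L1 by simp
    then show "Z 0 t + \<epsilon> * (exp (L * 0) - exp (L * (c - V * t))) \<le> 0"
      using bd(1)[OF t] eps by (simp add: mult_nonneg_nonpos)
    have "\<epsilon> * (exp (L * c) - exp (L * (c - V * t))) \<le> \<epsilon> * exp (L * c)"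
      using eps by (intro mult_left_mono) auto
    also have "\<dots> = \<eta>" by (simp add: \<epsilon>_def)
    finally show "Z c t + \<epsilon> * (exp (L * c) - exp (L * (c - V * t))) \<le> 0"
      using eta(2)[OF t] by linarith
  next
    fix x assume x: "x \<in> {0..c}"
    have "exp (L * x) - exp (L * (c - V * 0)) \<le> 0" using x L1 by simp
    then have "\<epsilon> * (exp (L * x) - exp (L * (c - V * 0))) \<le> 0" using eps by (intro mult_nonneg_nonpos) auto
    then show "Z x 0 + \<epsilon> * (exp (L * x) - exp (L * (c - V * 0))) \<le> 0"
      using bd(3)[OF x] by linarith
  next
    fix x t
    assume a: "0 < x" "x < c" "0 < t" "t \<le> \<tau>"
      and big: "0 < Z x t + \<epsilon> * (exp (L * x) - exp (L * (c - V * t)))"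
      and Y1: "Zx x t + \<epsilon> * (L * exp (L * x)) = 0"
      and Y2: "Zxx x t + \<epsilon> * (L * (L * exp (L * x))) \<le> 0"
      and Y3: "0 \<le> Zt x t + \<epsilon> * (L * V * exp (L * (c - V * t)))"
    define q where "q = \<epsilon> * exp (L * x)"
    define w where "w = \<epsilon> * exp (L * (c - V * t))"
    define I where "I = integral {0..x} (\<lambda>y. S y t * Z y t)"
    have q: "q > 0" and w: "w > 0" using eps by (auto simp: q_def w_def)
    have xin: "x \<in> {0..c}" and tin: "t \<in> {0..\<tau>}" using a by auto
    have Z0: "Z x t \<le> 0" by (rule nonpos[OF xin tin])
    have Zq: "Z x t + (q - w) > 0" using big by (simp add: q_def w_def algebra_simps)
    \<comment> \<open>As \<open>Z \<le> 0\<close>, a positive sum can occur only to the right of the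
      zero of the barrier; there both \<open>w\<close> and the modulus of \<open>Z\<close> are at
      most \<open>q\<close>.\<close>
    then have wq: "w \<le> q" using Z0 by linarith
    have I: "I \<ge> 0"
    proof -
      have "I \<ge> 0 * x" unfolding I_def
        by (rule integral_ge_const[OF _ SZ[OF xin tin]])
          (use a S nonpos in \<open>auto intro!: mult_nonpos_nonpos\<close>)
      then show ?thesis by simp
    qed
    have Zx: "Zx x t = - (L * q)" using Y1 by (simp add: q_def algebra_simps)
    have b: "\<beta> x t * Zx x t \<ge> - C * (L * q)"
    proof -
      have "\<beta> x t * (L * q) \<le> C * (L * q)"
        using coef[OF xin tin] L1 q by (intro mult_right_mono) auto
      then show ?thesis by (simp add: Zx)
    qed
    have r: "R x t * Z x t \<le> C * q"
    proof -
      have "\<bar>R x t\<bar> * \<bar>Z x t\<bar> \<le> C * q"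
        using coef[OF xin tin] Z0 Zq w C0 by (intro mult_mono) auto
      then show ?thesis by (metis abs_le_D1 abs_mult)
    qed
    have "L * V * w \<le> L * V * q" using wq L1 V by (intro mult_left_mono) auto
    then have "Zt x t \<ge> - (L * V * q)" using Y3 by (simp add: w_def algebra_simps)
    then have "- (L * V + C * L + C) * q \<le> Zt x t + \<beta> x t * Zx x t - R x t * Z x t + I"
      using b r I by (simp add: algebra_simps)
    then have "\<rho> x t * (- (L * V + C * L + C) * q) \<le> \<rho> x t * (Zt x t + \<beta> x t * Zx x t - R x t * Z x t + I)"
      using rho[OF xin tin] by (intro mult_left_mono) auto
    also have "\<dots> = \<mu> * Zxx x t" unfolding eq[OF a] I_def ..
    finally have "\<mu> * Zxx x t \<ge> - (\<rho> x t * ((L * V + C * L + C) * q))" by (simp add: algebra_simps)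
    moreover have "\<rho> x t * ((L * V + C * L + C) * q) \<le> C * ((L * V + C * L + C) * q)"
      using rho[OF xin tin] C0 L1 q V by (intro mult_right_mono) auto
    moreover have "\<mu> * Zxx x t \<le> \<mu> * (- (L\<^sup>2 * q))"
      using Y2 pos by (intro mult_left_mono) (auto simp: q_def power2_eq_square algebra_simps)
    ultimately have "\<mu> * L\<^sup>2 * q \<le> C * (L * V + C * L + C) * q" by (simp add: algebra_simps)
    then show False using L q by simp
  qed
  \<comment> \<open>At \<open>t = \<tau>\<close> the zero of the barrier has reached
    \<open>x = 0\<close>, and \<open>exp s \<ge> 1 + s\<close> makes the bound linear.\<close>
  have "Z x \<tau> \<le> - (\<epsilon> * L) * x" if x: "x \<in> {0..c}" for x
  proof -
    have "Z x \<tau> + \<epsilon> * (exp (L * x) - 1) \<le> 0"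
      using barrier[OF x, of \<tau>] pos by (simp add: V_def)
    moreover have "\<epsilon> * (exp (L * x) - 1) \<ge> \<epsilon> * (L * x)"
      by (intro mult_left_mono) (use eps exp_ge_add_one_self[of "L * x"] in linarith)+
    ultimately show ?thesis by simp
  qed
  then show ?thesis using eps L1 by (intro exI[of _ "\<epsilon> * L"]) auto
qed

section \<open>Functions on a space-time rectangle\<close>

abbreviation cts :: "real \<Rightarrow> (real \<Rightarrow> real \<Rightarrow> real) \<Rightarrow> bool" where
  "cts T f \<equiv> continuous_on ({0..1} \<times> {0..T}) (\<lambda>z. f (fst z) (snd z))"

lemma C21D:
  assumes "C21 T f fx fxx ft"
  shows "cts T f" "cts T fx" "cts T fxx" "cts T ft"
    and "\<And>x t. x \<in> {0..1} \<Longrightarrow> t \<in> {0..T} \<Longrightarrow>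
      ((\<lambda>y. f y t) has_real_derivative fx x t) (at x within {0..1})"
    and "\<And>x t. x \<in> {0..1} \<Longrightarrow> t \<in> {0..T} \<Longrightarrow>
      ((\<lambda>y. fx y t) has_real_derivative fxx x t) (at x within {0..1})"
    and "\<And>x t. x \<in> {0..1} \<Longrightarrow> t \<in> {0..T} \<Longrightarrow>
      ((\<lambda>s. f x s) has_real_derivative ft x t) (at t within {0..T})"
  using assms by (auto simp: C21_def case_prod_unfold)

lemma cts_slice_x: "cts T f \<Longrightarrow> t \<in> {0..T} \<Longrightarrow> continuous_on {0..1} (\<lambda>x. f x t)"
  by (rule continuous_on_compose2[of "{0..1} \<times> {0..T}" "\<lambda>z. f (fst z) (snd z)" _ "\<lambda>x. (x, t)", simplified])
    (auto intro!: continuous_intros)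

lemma cts_slice_t: "cts T f \<Longrightarrow> x \<in> {0..1} \<Longrightarrow> continuous_on {0..T} (\<lambda>t. f x t)"
  by (rule continuous_on_compose2[of "{0..1} \<times> {0..T}" "\<lambda>z. f (fst z) (snd z)" _ "\<lambda>t. (x, t)", simplified])
    (auto intro!: continuous_intros)

lemma cts_bounded:
  assumes "cts T f"
  shows "\<exists>B>0. \<forall>x\<in>{0..1}. \<forall>t\<in>{0..T}. \<bar>f x t\<bar> \<le> B"
proof -
  have "compact ((\<lambda>z. f (fst z) (snd z)) ` ({0..1} \<times> {0..T}))"
    by (intro compact_continuous_image assms compact_Times) auto
  then have "bounded ((\<lambda>z. f (fst z) (snd z)) ` ({0..1} \<times> {0..T}))" by (rule compact_imp_bounded)
  then show ?thesis unfolding bounded_pos by force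
qed

text \<open>Interior points at positive times are dense in the rectangle, so the equations become
  available at \<open>t = 0\<close> and on the lateral boundary.\<close>

lemma zero_on_closure:
  assumes "T > 0" "cts T f"
    and zero: "\<And>x t. x \<in> {0<..<1} \<Longrightarrow> t \<in> {0<..T} \<Longrightarrow> f x t = 0"
    and "x \<in> {0..1}" "t \<in> {0..T}"
  shows "f x t = 0"
proof -
  have cl: "closure ({0<..<1::real} \<times> {0<..T}) = {0..1} \<times> {0..T}"
    using assms(1) by (simp add: closure_Times)
  have "(\<lambda>z. f (fst z) (snd z)) (x, t) = 0"
    by (rule continuous_constant_on_closure[of "{0<..<1::real} \<times> {0<..T}"])
      (use assms in \<open>auto simp: cl\<close>)
  then show ?thesis by simp
qed

text \<open>Stands in for integration by parts: an integral identity is checked by differentiating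
  both sides in \<open>x\<close> and comparing them at \<open>x = 0\<close>.\<close>

lemma eq_by_deriv:
  fixes f g h :: "real \<Rightarrow> real"
  assumes "\<And>y. y \<in> {0..1} \<Longrightarrow> (f has_real_derivative h y) (at y within {0..1})"
    and "\<And>y. y \<in> {0..1} \<Longrightarrow> (g has_real_derivative h y) (at y within {0..1})"
    and "f 0 = g 0" "x \<in> {0..1}"
  shows "f x = g x"
proof -
  have "((\<lambda>y. f y - g y) has_real_derivative 0) (at y within {0..1})" if "y \<in> {0..1}" for y
    using DERIV_diff[OF assms(1,2)[OF that]] by simp
  then obtain k where "\<And>y. y \<in> {0..1} \<Longrightarrow> f y - g y = k"
    using has_field_derivative_zero_constant[of "{0..1}" "\<lambda>y. f y - g y"] by auto
  from this[of 0] this[of x] show ?thesis using assms(3,4) by simp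
qed

section \<open>Primitives in \<open>x\<close> of functions on the rectangle\<close>

lemma primitive_deriv_x:
  assumes "cts T f" "x \<in> {0..1}" "t \<in> {0..T}"
  shows "((\<lambda>x. integral {0..x} (\<lambda>y. f y t)) has_real_derivative f x t) (at x within {0..1})"
  by (rule integral_has_real_derivative[OF cts_slice_x[OF assms(1,3)] assms(2)])

lemma primitive_deriv_t:
  assumes "cts T ft"
    and D: "\<And>x t. x \<in> {0..1} \<Longrightarrow> t \<in> {0..T} \<Longrightarrow>
      ((\<lambda>s. f x s) has_real_derivative ft x t) (at t within {0..T})"
    and f: "cts T f"
    and x: "x \<in> {0..1}" and t: "t \<in> {0..T}"
  shows "((\<lambda>t. integral {0..x} (\<lambda>y. f y t)) has_real_derivative integral {0..x} (\<lambda>y. ft y t))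
    (at t within {0..T})"
proof -
  have "((\<lambda>t. integral (cbox 0 x) (\<lambda>y. f y t)) has_real_derivative integral (cbox 0 x) (\<lambda>y. ft y t))
    (at t within {0..T})"
  proof (rule leibniz_rule_field_derivative)
    show "(\<lambda>y. f y s) integrable_on cbox 0 x" if "s \<in> {0..T}" for s
      using x by (intro integrable_continuous continuous_on_subset[OF cts_slice_x[OF f that]]) auto
    show "continuous_on ({0..T} \<times> cbox 0 x) (\<lambda>(s, y). ft y s)"
      unfolding case_prod_unfold
      by (rule continuous_on_compose2[OF assms(1), of _ "\<lambda>z. (snd z, fst z)", simplified])
        (use x in \<open>auto intro!: continuous_intros\<close>)
  qed (use D x t in auto)
  then show ?thesis by simp
qed

text \<open>The substitution \<open>y = x * s\<close> moves \<open>x\<close> from the limit of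
  integration into the integrand, where continuity of parameter integrals over a fixed interval
  applies.\<close>

lemma primitive_cts:
  assumes "cts T f"
  shows "cts T (\<lambda>x t. integral {0..x} (\<lambda>y. f y t))"
proof -
  have sub: "integral {0..x} (\<lambda>y. f y t) = x * integral {0..1} (\<lambda>s. f (x * s) t)"
    if xt: "x \<in> {0..1}" "t \<in> {0..T}" for x t
  proof (cases "x = 0")
    case False
    then have x: "x > 0" using xt by auto
    have "(\<lambda>y. f y t) integrable_on {0..x}"
      using xt by (intro integrable_continuous_real continuous_on_subset[OF cts_slice_x[OF assms]]) auto
    then have "((\<lambda>y. f y t) has_integral integral {0..x} (\<lambda>y. f y t)) {0..x}" by blast
    from has_integral_stretch_real[OF this False]
    have "((\<lambda>s. f (x * s) t) has_integral 1 / \<bar>x\<bar> * integral {0..x} (\<lambda>y. f y t)) ((\<lambda>s. s / x) ` {0..x})"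
      by simp
    moreover have "(\<lambda>s. s / x) ` {0..x} = {0..1}"
      using x by simp
    ultimately have "integral {0..1} (\<lambda>s. f (x * s) t) = 1 / x * integral {0..x} (\<lambda>y. f y t)"
      using x by (simp add: integral_unique)
    then show ?thesis using x by simp
  qed simp
  have "continuous_on ({0..1} \<times> {0..T}) (\<lambda>z. integral (cbox 0 1) (\<lambda>s. f (fst z * s) (snd z)))"
  proof (rule integral_continuous_on_param)
    show "continuous_on (({0..1} \<times> {0..T}) \<times> cbox 0 1) (\<lambda>(z, s). f (fst z * s) (snd z))"
      unfolding case_prod_unfold
      by (rule continuous_on_compose2[OF assms, of _ "\<lambda>w. (fst (fst w) * snd w, snd (fst w))", simplified])
        (auto intro!: continuous_intros mult_le_one)
  qed
  then have "continuous_on ({0..1} \<times> {0..T}) (\<lambda>z. fst z * integral {0..1} (\<lambda>s. f (fst z * s) (snd z)))"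
    by (auto intro!: continuous_intros)
  then show ?thesis by (rule continuous_on_eq) (auto simp: sub)
qed

section \<open>The weighted integral of the effective stress\<close>

text \<open>The equations are posed on the closed rectangle with the derivatives expanded:
  \<open>u\<close> times the mass equation has been subtracted from the momentum equation, and the
  terms with \<open>ux\<close> in the energy equation are merged into
  \<open>\<gamma> * r * e * ux\<close>.\<close>

locale vacuum_flow =
  fixes \<mu> \<gamma> T :: real
    and r rx rxx rt u ux uxx ut e ex exx et :: "real \<Rightarrow> real \<Rightarrow> real"
  assumes mu: "\<mu> > 0" and gam: "\<gamma> > 1" and T: "T > 0"
    and r_C21: "C21 T r rx rxx rt" and u_C21: "C21 T u ux uxx ut" and e_C21: "C21 T e ex exx et"
    and mass: "\<And>x t. x \<in> {0..1} \<Longrightarrow> t \<in> {0..T} \<Longrightarrow>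
      rt x t = - (rx x t * u x t + r x t * ux x t)"
    and momentum: "\<And>x t. x \<in> {0..1} \<Longrightarrow> t \<in> {0..T} \<Longrightarrow>
      r x t * (ut x t + u x t * ux x t) = \<mu> * uxx x t - (\<gamma> - 1) * (rx x t * e x t + r x t * ex x t)"
    and energy: "\<And>x t. x \<in> {0..1} \<Longrightarrow> t \<in> {0..T} \<Longrightarrow>
      (rt x t * e x t + r x t * et x t) + u x t * (rx x t * e x t + r x t * ex x t)
        + \<gamma> * r x t * e x t * ux x t = \<mu> * (ux x t)\<^sup>2"
    and r_bdry: "\<And>t. t \<in> {0..T} \<Longrightarrow> r 0 t = 0" "\<And>t. t \<in> {0..T} \<Longrightarrow> r 1 t = 0"
    and u_bdry: "\<And>t. t \<in> {0..T} \<Longrightarrow> u 0 t = 0" "\<And>t. t \<in> {0..T} \<Longrightarrow> ux 0 t = 0"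
    and r_init: "\<And>x. x \<in> {0..1} \<Longrightarrow> r x 0 \<ge> 0"
begin

text \<open>At a negative interior minimum of \<open>exp (- (\<Lambda> * t)) * r\<close> one has
  \<open>rx = 0\<close>, so the mass equation leaves \<open>rt = - ux * r\<close>; as
  \<open>\<Lambda>\<close> exceeds the modulus of \<open>ux\<close>, the time derivative has the
  wrong sign.\<close>

lemma density_nonneg:
  assumes xt: "x \<in> {0..1}" "t \<in> {0..T}"
  shows "r x t \<ge> 0"
proof -
  note r = C21D[OF r_C21] and u = C21D[OF u_C21]
  obtain B where B: "B > 0" "\<And>x t. x \<in> {0..1} \<Longrightarrow> t \<in> {0..T} \<Longrightarrow> \<bar>ux x t\<bar> \<le> B"
    using cts_bounded[OF u(2)] by blast
  define \<Lambda> where "\<Lambda> = B + 1"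
  have at: "at x within {0..1} = at x" if "0 < x" "x < 1" for x :: real
    using that by (simp add: at_within_Icc_at)
  have "- (exp (- (\<Lambda> * t)) * r x t) \<le> 0"
  proof (rule parabolic_max_point[where Y = "\<lambda>x t. - (exp (- (\<Lambda> * t)) * r x t)" and c = 1 and \<tau> = T
        and Yx = "\<lambda>x t. - (exp (- (\<Lambda> * t)) * rx x t)" and Yxx = "\<lambda>x t. - (exp (- (\<Lambda> * t)) * rxx x t)"
        and Yt = "\<lambda>x t. exp (- (\<Lambda> * t)) * (\<Lambda> * r x t - rt x t)", OF _ T _ _ _ _ _ _ _ _ xt])
    show "continuous_on ({0..1} \<times> {0..T}) (\<lambda>z. - (exp (- (\<Lambda> * snd z)) * r (fst z) (snd z)))"
      by (intro continuous_intros r)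
  next
    fix x t :: real assume a: "0 < x" "x < 1" "0 < t" "t \<le> T"
    show "((\<lambda>y. - (exp (- (\<Lambda> * t)) * r y t)) has_real_derivative - (exp (- (\<Lambda> * t)) * rx x t)) (at x)"
      using r(5)[of x t] a by (auto intro!: derivative_eq_intros simp: at)
    show "((\<lambda>y. - (exp (- (\<Lambda> * t)) * rx y t)) has_real_derivative - (exp (- (\<Lambda> * t)) * rxx x t)) (at x)"
      using r(6)[of x t] a by (auto intro!: derivative_eq_intros simp: at)
    show "((\<lambda>s. - (exp (- (\<Lambda> * s)) * r x s)) has_real_derivative
        exp (- (\<Lambda> * t)) * (\<Lambda> * r x t - rt x t)) (at t within {0..T})"
      using r(7)[of x t] a by (auto intro!: derivative_eq_intros simp: algebra_simps)
  next
    fix x t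
    assume a: "0 < x" "x < 1" "0 < t" "t \<le> T" and big: "0 < - (exp (- (\<Lambda> * t)) * r x t)"
      and Y1: "- (exp (- (\<Lambda> * t)) * rx x t) = 0"
      and Y3: "0 \<le> exp (- (\<Lambda> * t)) * (\<Lambda> * r x t - rt x t)"
    have "r x t < 0" "rx x t = 0" using big Y1 by (auto simp: zero_less_mult_iff mult_less_0_iff)
    moreover have "\<Lambda> * r x t - rt x t \<ge> 0" using Y3 by (simp add: zero_le_mult_iff)
    ultimately have "(\<Lambda> + ux x t) * r x t \<ge> 0" "r x t < 0"
      using mass[of x t] a by (auto simp: algebra_simps)
    moreover have "\<Lambda> + ux x t > 0" using B(2)[of x t] a by (auto simp: \<Lambda>_def)
    ultimately show False by (simp add: zero_le_mult_iff)
  qed (use r_bdry r_init in auto)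
  then show ?thesis by (simp add: zero_le_mult_iff)
qed

end

text \<open>\<open>F\<close> is the effective stress, \<open>A\<close> the acceleration
  of the fluid, \<open>- D\<close> the derivative of the weight \<open>g\<close> along particle paths, and \<open>Rx\<close> the
  \<open>x\<close>-derivative of \<open>R = Q / g\<close>.\<close>

locale weighted_vacuum_flow = vacuum_flow +
  fixes k kx kxx kt :: "real \<Rightarrow> real \<Rightarrow> real"
  assumes k_C21: "C21 T k kx kxx kt"
begin

definition p where "p x t = (\<gamma> - 1) * r x t * e x t"
definition px where "px x t = (\<gamma> - 1) * (rx x t * e x t + r x t * ex x t)"
definition pt where "pt x t = (\<gamma> - 1) * (rt x t * e x t + r x t * et x t)"
definition F where "F x t = \<mu> * ux x t - p x t"
definition A where "A x t = ut x t + u x t * ux x t"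
definition g where "g x t = 1 - integral {0..x} (\<lambda>y. r y t * k y t)"
definition D where "D x t = integral {0..x} (\<lambda>y. r y t * (u y t * kx y t + kt y t))"
definition gt where "gt x t = r x t * u x t * k x t - D x t"
definition h where "h x t = \<mu> * r x t * k x t * u x t - g x t * p x t"
definition ht where "ht x t = \<mu> * (rt x t * k x t + r x t * kt x t) * u x t
  + \<mu> * r x t * k x t * ut x t - gt x t * p x t - g x t * pt x t"
text \<open>This is the integral of \<open>g * F\<close> over \<open>[0, x]\<close> after
  integration by parts, with \<open>u = 0\<close> at \<open>x = 0\<close> and \<open>- r * k\<close>
  as the \<open>x\<close>-derivative of \<open>g\<close>. In this form it contains \<open>u\<close>
  instead of \<open>ux\<close>.\<close>

definition Z where "Z x t = \<mu> * g x t * u x t + integral {0..x} (\<lambda>y. h y t)"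
definition Q where "Q x t = - D x t - (\<gamma> - 1) * g x t * ux x t - \<mu> * kx x t"
definition Qx where "Qx x t = - r x t * (u x t * kx x t + kt x t) + (\<gamma> - 1) * r x t * k x t * ux x t
  - (\<gamma> - 1) * g x t * uxx x t - \<mu> * kxx x t"
definition Rx where "Rx x t = (Qx x t * g x t + Q x t * (r x t * k x t)) / (g x t)\<^sup>2"
definition Zt where "Zt x t = \<mu> * g x t * A x t - u x t * g x t * F x t + \<mu> * k x t * F x t
  + integral {0..x} (\<lambda>y. Q y t * F y t)"
definition Zxx where "Zxx x t = - r x t * k x t * F x t + g x t * r x t * A x t"

lemmas rD = C21D[OF r_C21] and uD = C21D[OF u_C21] and eD = C21D[OF e_C21] and kD = C21D[OF k_C21]

section \<open>Regularity and derivatives of the weighted quantities\<close>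

lemma cts_flow:
  "cts T p" "cts T pt" "cts T F" "cts T A" "cts T g" "cts T D" "cts T gt" "cts T h" "cts T ht"
  "cts T Z" "cts T Q" "cts T Qx"
proof -
  show p: "cts T p" "cts T pt" unfolding p_def pt_def by (intro continuous_intros rD eD)+
  show "cts T F" unfolding F_def by (intro continuous_intros uD p)
  show "cts T A" unfolding A_def by (intro continuous_intros uD)
  have "cts T (\<lambda>x t. integral {0..x} (\<lambda>y. r y t * k y t))"
    by (rule primitive_cts) (intro continuous_intros rD kD)
  then show g: "cts T g" unfolding g_def by (intro continuous_intros)
  show D: "cts T D" unfolding D_def
    by (rule primitive_cts) (intro continuous_intros rD kD uD)
  show gt: "cts T gt" unfolding gt_def by (intro continuous_intros rD kD uD D)
  show h: "cts T h" unfolding h_def by (intro continuous_intros rD kD uD p g)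
  show "cts T ht" unfolding ht_def by (intro continuous_intros rD kD uD p g gt)
  have "cts T (\<lambda>x t. integral {0..x} (\<lambda>y. h y t))" by (rule primitive_cts[OF h])
  then show "cts T Z" unfolding Z_def by (intro continuous_intros uD g)
  show "cts T Q" unfolding Q_def by (intro continuous_intros uD g D kD)
  show "cts T Qx" unfolding Qx_def by (intro continuous_intros uD g D kD rD)
qed

context
  fixes x t :: real assumes x: "x \<in> {0..1}" and t: "t \<in> {0..T}"
begin

lemma p_deriv_x: "((\<lambda>y. p y t) has_real_derivative px x t) (at x within {0..1})"
  unfolding p_def px_def
  by (rule derivative_eq_intros rD(5)[OF x t] eD(5)[OF x t] refl)+ (simp add: algebra_simps)

lemma p_deriv_t: "((\<lambda>s. p x s) has_real_derivative pt x t) (at t within {0..T})"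
  unfolding p_def pt_def
  by (rule derivative_eq_intros rD(7)[OF x t] eD(7)[OF x t] refl)+ (simp add: algebra_simps)

lemma F_deriv_x: "((\<lambda>y. F y t) has_real_derivative r x t * A x t) (at x within {0..1})"
  unfolding F_def
  by (rule derivative_eq_intros uD(6)[OF x t] p_deriv_x refl)+
    (use momentum[OF x t] in \<open>simp add: A_def px_def\<close>)

lemma g_deriv_x: "((\<lambda>y. g y t) has_real_derivative - (r x t * k x t)) (at x within {0..1})"
proof -
  have "cts T (\<lambda>x t. r x t * k x t)" by (intro continuous_intros rD kD)
  note primitive_deriv_x[OF this x t]
  then show ?thesis unfolding g_def by (auto intro!: derivative_eq_intros)
qed

lemma D_deriv_x: "((\<lambda>y. D y t) has_real_derivative r x t * (u x t * kx x t + kt x t)) (at x within {0..1})"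
  unfolding D_def by (rule primitive_deriv_x[OF _ x t]) (intro continuous_intros rD kD uD)

end

lemma gt_deriv_x:
  assumes x: "x \<in> {0..1}" and t: "t \<in> {0..T}"
  shows "((\<lambda>y. gt y t) has_real_derivative - (rt x t * k x t + r x t * kt x t)) (at x within {0..1})"
  unfolding gt_def
  by (rule derivative_eq_intros uD(5)[OF x t] rD(5)[OF x t] kD(5)[OF x t] D_deriv_x[OF x t] refl)+
    (simp add: mass[OF x t] algebra_simps)

text \<open>Differentiation under the integral produces \<open>rt\<close>; the mass equation turns
  it into the flux \<open>r * u * k\<close> and the integral \<open>D\<close>, the flux vanishing at
  \<open>x = 0\<close>.\<close>

lemma g_deriv_t:
  assumes x: "x \<in> {0..1}" and t: "t \<in> {0..T}"
  shows "((\<lambda>s. g x s) has_real_derivative gt x t) (at t within {0..T})"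
proof -
  have c: "cts T (\<lambda>x t. r x t * k x t)" "cts T (\<lambda>x t. rt x t * k x t + r x t * kt x t)"
    by (intro continuous_intros rD kD)+
  have "((\<lambda>t. integral {0..x} (\<lambda>y. r y t * k y t)) has_real_derivative
      integral {0..x} (\<lambda>y. rt y t * k y t + r y t * kt y t)) (at t within {0..T})"
    by (rule primitive_deriv_t[OF c(2) _ c(1) x t])
      (rule derivative_eq_intros rD(7) kD(7) refl | assumption | simp add: algebra_simps)+
  moreover have "- integral {0..x} (\<lambda>y. rt y t * k y t + r y t * kt y t) = gt x t"
  proof (rule eq_by_deriv[OF _ _ _ x])
    fix y :: real assume y: "y \<in> {0..1}"
    show "((\<lambda>x. - integral {0..x} (\<lambda>y. rt y t * k y t + r y t * kt y t)) has_real_derivative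
        - (rt y t * k y t + r y t * kt y t)) (at y within {0..1})"
      by (rule DERIV_minus[OF primitive_deriv_x[OF c(2) y t]])
    show "((\<lambda>y. gt y t) has_real_derivative - (rt y t * k y t + r y t * kt y t)) (at y within {0..1})"
      by (rule gt_deriv_x[OF y t])
  qed (simp add: gt_def D_def u_bdry[OF t])
  ultimately show ?thesis unfolding g_def by (auto intro!: derivative_eq_intros)
qed

lemma Z_deriv_x:
  assumes x: "x \<in> {0..1}" and t: "t \<in> {0..T}"
  shows "((\<lambda>y. Z y t) has_real_derivative g x t * F x t) (at x within {0..1})"
  unfolding Z_def
  by (rule derivative_eq_intros uD(5)[OF x t] g_deriv_x[OF x t] primitive_deriv_x[OF cts_flow(8) x t] refl)+
    (simp add: h_def F_def algebra_simps)

lemma Z_deriv_xx: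
  assumes x: "x \<in> {0..1}" and t: "t \<in> {0..T}"
  shows "((\<lambda>y. g y t * F y t) has_real_derivative Zxx x t) (at x within {0..1})"
  by (rule derivative_eq_intros F_deriv_x[OF x t] g_deriv_x[OF x t] refl)+
    (simp add: Zxx_def algebra_simps)

lemma h_deriv_t:
  assumes x: "x \<in> {0..1}" and t: "t \<in> {0..T}"
  shows "((\<lambda>s. h x s) has_real_derivative ht x t) (at t within {0..T})"
  unfolding h_def
  by (rule derivative_eq_intros uD(7)[OF x t] rD(7)[OF x t] kD(7)[OF x t] g_deriv_t[OF x t] p_deriv_t[OF x t] refl)+
    (simp add: ht_def algebra_simps)

section \<open>The evolution equation of \<open>Z\<close>\<close>

lemma F_bdry: "t \<in> {0..T} \<Longrightarrow> F 0 t = 0"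
  by (simp add: F_def p_def u_bdry r_bdry)

text \<open>In the energy equation the viscous heating and part of the pressure work combine to
  \<open>ux * F\<close>, so that apart from transport the pressure has a source proportional to
  \<open>F\<close>.\<close>

lemma pressure_eq:
  assumes x: "x \<in> {0..1}" and t: "t \<in> {0..T}"
  shows "pt x t = (\<gamma> - 1) * ux x t * F x t - (ux x t * p x t + u x t * px x t)"
proof -
  have "(\<gamma> - 1) * (\<mu> * (ux x t)\<^sup>2) = pt x t + u x t * px x t + \<gamma> * p x t * ux x t"
    unfolding energy[OF x t, symmetric] pt_def px_def p_def by (simp add: algebra_simps)
  then show ?thesis by (simp add: F_def power2_eq_square algebra_simps)
qed

text \<open>Only \<open>u\<close>, not \<open>ux\<close>, is differentiable in time, so the evolution of \<open>Z\<close> is obtained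
  from its definition rather than by integrating an equation for \<open>F\<close>.\<close>

lemma Z_deriv_t:
  assumes x: "x \<in> {0..1}" and t: "t \<in> {0..T}"
  shows "((\<lambda>s. Z x s) has_real_derivative Zt x t) (at t within {0..T})"
proof -
  have QF: "cts T (\<lambda>x t. Q x t * F x t)" by (intro continuous_intros cts_flow)
  \<comment> \<open>Both sides vanish at \<open>x = 0\<close>. Comparing
    \<open>x\<close>-derivatives explains \<open>Q\<close>: \<open>- D\<close> comes from
    \<open>gt\<close>, the term with \<open>\<gamma> - 1\<close> from \<open>pressure_eq\<close>,
    and \<open>- \<mu> * kx\<close> cancels the derivative of \<open>k\<close> in
    \<open>\<mu> * k * F\<close>.\<close>
  have eq: "\<mu> * gt x t * u x t + integral {0..x} (\<lambda>y. ht y t)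
      = u x t * g x t * p x t + \<mu> * k x t * F x t + integral {0..x} (\<lambda>y. Q y t * F y t)"
  proof (rule eq_by_deriv[OF _ _ _ x])
    fix y :: real assume y: "y \<in> {0..1}"
    let ?d = "\<mu> * gt y t * ux y t + \<mu> * r y t * k y t * ut y t - gt y t * p y t - g y t * pt y t"
    show "((\<lambda>x. \<mu> * gt x t * u x t + integral {0..x} (\<lambda>y. ht y t)) has_real_derivative ?d)
        (at y within {0..1})"
      by (rule derivative_eq_intros gt_deriv_x[OF y t] uD(5)[OF y t] primitive_deriv_x[OF cts_flow(9) y t] refl)+
        (simp add: ht_def algebra_simps)
    show "((\<lambda>x. u x t * g x t * p x t + \<mu> * k x t * F x t + integral {0..x} (\<lambda>y. Q y t * F y t))
        has_real_derivative ?d) (at y within {0..1})"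
      by (rule derivative_eq_intros g_deriv_x[OF y t] uD(5)[OF y t] p_deriv_x[OF y t] kD(5)[OF y t]
          F_deriv_x[OF y t] primitive_deriv_x[OF QF y t] refl)+
        (simp add: pressure_eq[OF y t] Q_def gt_def A_def F_def algebra_simps)
  qed (simp add: u_bdry[OF t] F_bdry[OF t])
  have "((\<lambda>s. Z x s) has_real_derivative
      \<mu> * gt x t * u x t + \<mu> * g x t * ut x t + integral {0..x} (\<lambda>y. ht y t)) (at t within {0..T})"
    unfolding Z_def
    by (rule derivative_eq_intros g_deriv_t[OF x t] uD(7)[OF x t]
        primitive_deriv_t[OF cts_flow(9) h_deriv_t cts_flow(8) x t] refl | assumption)+ simp
  moreover have "\<mu> * gt x t * u x t + \<mu> * g x t * ut x t + integral {0..x} (\<lambda>y. ht y t) = Zt x t"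
    using eq by (simp add: Zt_def A_def F_def[of x t] algebra_simps)
  ultimately show ?thesis by simp
qed

text \<open>As \<open>g * F\<close> is the \<open>x\<close>-derivative of \<open>Z\<close>,
  integrating \<open>Q / g\<close> against it by parts expresses the integral of
  \<open>Q * F\<close> through \<open>Z\<close> and \<open>Rx\<close>. The factor 2 in the drift
  collects one \<open>\<mu> * k * F\<close> from \<open>Zt\<close> and one from
  \<open>Zxx\<close>.\<close>

lemma Z_equation:
  assumes x: "x \<in> {0..1}" and t: "t \<in> {0..T}" and g_pos: "\<And>y. y \<in> {0..1} \<Longrightarrow> g y t > 0"
  shows "\<mu> * Zxx x t = r x t * (Zt x t + (u x t - 2 * \<mu> * k x t / g x t) * (g x t * F x t)
    - Q x t / g x t * Z x t + integral {0..x} (\<lambda>y. Rx y t * Z y t))"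
proof -
  have QF: "cts T (\<lambda>x t. Q x t * F x t)" by (intro continuous_intros cts_flow)
  have RZ: "continuous_on {0..1} (\<lambda>x. Rx x t * Z x t)"
    unfolding Rx_def
    by (intro continuous_intros cts_slice_x[OF _ t] cts_flow rD kD) (use g_pos in force)
  have QF_RZ: "integral {0..x} (\<lambda>y. Q y t * F y t) = Q x t / g x t * Z x t - integral {0..x} (\<lambda>y. Rx y t * Z y t)"
  proof (rule eq_by_deriv[OF _ _ _ x])
    fix y :: real assume y: "y \<in> {0..1}"
    show "((\<lambda>x. integral {0..x} (\<lambda>y. Q y t * F y t)) has_real_derivative Q y t * F y t) (at y within {0..1})"
      by (rule primitive_deriv_x[OF QF y t])
    have Qd: "((\<lambda>y. Q y t) has_real_derivative Qx y t) (at y within {0..1})"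
      unfolding Q_def
      by (rule derivative_eq_intros g_deriv_x[OF y t] uD(6)[OF y t] D_deriv_x[OF y t] kD(6)[OF y t] refl)+
        (simp add: Qx_def algebra_simps)
    have Rd: "((\<lambda>y. Q y t / g y t) has_real_derivative Rx y t) (at y within {0..1})"
      by (rule derivative_eq_intros Qd g_deriv_x[OF y t] refl)+
        (use g_pos[OF y] in \<open>auto simp: Rx_def power2_eq_square algebra_simps\<close>)
    show "((\<lambda>x. Q x t / g x t * Z x t - integral {0..x} (\<lambda>y. Rx y t * Z y t)) has_real_derivative
        Q y t * F y t) (at y within {0..1})"
      by (rule derivative_eq_intros Rd Z_deriv_x[OF y t] integral_has_real_derivative[OF RZ y] refl)+
        (use g_pos[OF y] in simp)
  qed (simp add: Z_def u_bdry[OF t])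
  have "2 * \<mu> * k x t / g x t * (g x t * F x t) = 2 * \<mu> * k x t * F x t"
    using g_pos[OF x] by simp
  then have E: "Zt x t + (u x t - 2 * \<mu> * k x t / g x t) * (g x t * F x t)
      - Q x t / g x t * Z x t + integral {0..x} (\<lambda>y. Rx y t * Z y t) = \<mu> * g x t * A x t - \<mu> * k x t * F x t"
    unfolding Zt_def QF_RZ left_diff_distrib by simp
  show ?thesis unfolding E by (simp add: Zxx_def algebra_simps)
qed

section \<open>Size of the weight and sign of the initial \<open>Z\<close>\<close>

lemma g_bounds:
  assumes x: "x \<in> {0..1}" and t: "t \<in> {0..T}"
    and rk: "\<And>y. y \<in> {0..1} \<Longrightarrow> 0 \<le> r y t * k y t \<and> r y t * k y t \<le> 1 / 2"
  shows "1 / 2 \<le> g x t" "g x t \<le> 1"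
proof -
  have cont: "continuous_on {0..x} (\<lambda>y. r y t * k y t)"
    by (rule continuous_on_subset[of "{0..1}"])
      (use x in \<open>auto intro!: continuous_intros cts_slice_x[OF _ t] rD kD\<close>)
  have "0 * x \<le> integral {0..x} (\<lambda>y. r y t * k y t)"
    by (rule integral_ge_const) (use x rk cont in auto)
  moreover have "(- (1 / 2)) * x \<le> integral {0..x} (\<lambda>y. - (r y t * k y t))"
    by (rule integral_ge_const) (use x rk cont in \<open>auto intro!: continuous_intros\<close>)
  ultimately show "1 / 2 \<le> g x t" "g x t \<le> 1" using x by (auto simp: g_def)
qed

text \<open>With these signs both terms of \<open>h\<close> are nonpositive; dropping their integral
  leaves a bound that is strictly negative where \<open>g > 0\<close> and
  \<open>u < 0\<close>.\<close>

lemma Z_init_le: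
  assumes x: "x \<in> {0..1}" and t: "t \<in> {0..T}"
    and sgn: "\<And>y. y \<in> {0..x} \<Longrightarrow> k y t \<ge> 0 \<and> g y t \<ge> 0 \<and> u y t \<le> 0 \<and> p y t \<ge> 0"
  shows "Z x t \<le> \<mu> * g x t * u x t"
proof -
  have "0 * x \<le> integral {0..x} (\<lambda>y. - h y t)"
  proof (rule integral_ge_const)
    show "continuous_on {0..x} (\<lambda>y. - h y t)"
      by (rule continuous_on_subset[of "{0..1}"])
        (use x in \<open>auto intro!: continuous_intros cts_slice_x[OF _ t] cts_flow\<close>)
    fix y assume y: "y \<in> {0..x}"
    have "r y t \<ge> 0" using x y t by (intro density_nonneg) auto
    then have "\<mu> * r y t * k y t * u y t \<le> 0" "g y t * p y t \<ge> 0"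
      using sgn[OF y] mu by (auto intro!: mult_nonneg_nonpos mult_nonneg_nonneg)
    then show "0 \<le> - h y t" by (simp add: h_def)
  qed (use x in auto)
  then show ?thesis by (simp add: Z_def)
qed

end

section \<open>Sign of \<open>Rx\<close> and the contradiction at \<open>x = 0\<close>\<close>

lemma has_small_slope_contradiction:
  fixes f :: "real \<Rightarrow> real"
  assumes "(f has_real_derivative 0) (at 0 within {0..1})" "f 0 = 0" "c > 0" "c \<le> 1" "\<epsilon> > 0"
    and le: "\<And>x. x \<in> {0..c} \<Longrightarrow> f x \<le> - \<epsilon> * x"
  shows False
proof -
  \<comment> \<open>The shifted function has positive slope at 0, so it exceeds 0 at once, whereas
    \<open>le\<close> keeps it nonpositive.\<close>
  have "((\<lambda>x. f x + \<epsilon> * x) has_real_derivative \<epsilon>) (at 0 within {0..1})"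
    using assms(1) by (auto intro!: derivative_eq_intros)
  then obtain d where d: "d > 0"
    "\<And>h. h > 0 \<Longrightarrow> 0 + h \<in> {0..1} \<Longrightarrow> h < d \<Longrightarrow> f 0 + \<epsilon> * 0 < f (0 + h) + \<epsilon> * (0 + h)"
    using has_real_derivative_pos_inc_right[of "\<lambda>x. f x + \<epsilon> * x" \<epsilon> 0 "{0..1}"] assms(5) by blast
  define h where "h = min d c / 2"
  have "h > 0" "h < d" "h \<le> c" using d(1) assms(3) by (auto simp: h_def min_def field_simps)
  then show False using d(2)[of h] le[of h] assms(2,4) by auto
qed

text \<open>Half of the initial minimum survives for a short time by uniform continuity. This keeps
  the density bounded below away from the vacuum point.\<close>

lemma pos_lower_bound_short_time:
  assumes f: "cts T f" and ab: "0 \<le> a" "a \<le> b" "b \<le> 1" and T: "T > 0"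
    and pos: "\<And>x. x \<in> {a..b} \<Longrightarrow> f x 0 > 0"
  shows "\<exists>m>0. \<exists>\<tau>>0. \<tau> \<le> T \<and> (\<forall>x\<in>{a..b}. \<forall>t\<in>{0..\<tau>}. f x t \<ge> m)"
proof -
  have "continuous_on {a..b} (\<lambda>x. f x 0)"
    using ab T by (intro continuous_on_subset[OF cts_slice_x[OF f]]) auto
  then obtain x0 where x0: "x0 \<in> {a..b}" "\<And>x. x \<in> {a..b} \<Longrightarrow> f x0 0 \<le> f x 0"
    using continuous_attains_inf[of "{a..b}" "\<lambda>x. f x 0"] ab by auto
  define m where "m = f x0 0 / 2"
  have m: "m > 0" using pos[OF x0(1)] by (simp add: m_def)
  have "uniformly_continuous_on ({0..1} \<times> {0..T}) (\<lambda>z. f (fst z) (snd z))"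
    by (intro compact_uniformly_continuous f compact_Times) auto
  then obtain d where d: "d > 0" "\<And>z w. z \<in> {0..1} \<times> {0..T} \<Longrightarrow> w \<in> {0..1} \<times> {0..T} \<Longrightarrow>
      dist w z < d \<Longrightarrow> dist (f (fst w) (snd w)) (f (fst z) (snd z)) < m"
    using m unfolding uniformly_continuous_on_def by blast
  define \<tau> where "\<tau> = min T (d / 2)"
  have "f x t \<ge> m" if x: "x \<in> {a..b}" and t: "t \<in> {0..\<tau>}" for x t
  proof -
    have "dist (x, t) (x, 0) < d" using t d(1) by (auto simp: dist_Pair_Pair \<tau>_def)
    then have "dist (f x t) (f x 0) < m"
      using d(2)[of "(x, 0)" "(x, t)"] x t ab T by (auto simp: \<tau>_def)
    then show ?thesis using x0(2)[OF x] unfolding dist_real_def m_def abs_less_iff by linarith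
  qed
  then show ?thesis using m d(1) T by (intro exI[of _ m] conjI exI[of _ \<tau>]) (auto simp: \<tau>_def)
qed

lemma cts_mono: "cts T f \<Longrightarrow> \<tau> \<le> T \<Longrightarrow> cts \<tau> f"
  by (erule continuous_on_subset) auto

context weighted_vacuum_flow
begin

text \<open>The sum \<open>r * kt + \<mu> * kxx\<close> enters \<open>Qx\<close> with a minus sign,
  while \<open>a\<close> bounds the rest of \<open>Qx\<close> and \<open>b\<close> bounds
  \<open>Q\<close> from above. The summand \<open>2 * C * b\<close> compensates
  \<open>Q * r * k \<le> C * b\<close>, its factor 2 paying for \<open>g \<ge> 1 / 2\<close>. The
  bound on \<open>D\<close> is one-sided, so the constants do not depend on the size of a
  nonnegative \<open>kt\<close>.\<close>

lemma Rx_nonpos: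
  assumes C: "C \<ge> 1" "\<bar>r x t\<bar> \<le> C" "\<bar>u x t\<bar> \<le> C" "\<bar>ux x t\<bar> \<le> C" "\<bar>uxx x t\<bar> \<le> C"
    and D: "- D x t \<le> C\<^sup>2" and g: "1 / 2 \<le> g x t" "g x t \<le> 1"
    and k: "0 \<le> k x t" "k x t \<le> 1" and kx: "\<bar>kx x t\<bar> \<le> 1" and r0: "r x t \<ge> 0"
    and ab: "a = C\<^sup>2 + (\<gamma> - 1) * C\<^sup>2 + (\<gamma> - 1) * C" "b = C\<^sup>2 + (\<gamma> - 1) * C + \<mu>"
    and large: "r x t * kt x t + \<mu> * kxx x t \<ge> a + 2 * C * b"
  shows "Rx x t \<le> 0"
proof -
  have b0: "b \<ge> 0" using gam mu C(1) unfolding ab by (intro add_nonneg_nonneg mult_nonneg_nonneg) auto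
  have gux: "\<bar>(\<gamma> - 1) * g x t * ux x t\<bar> \<le> (\<gamma> - 1) * 1 * C"
    unfolding abs_mult using gam g C by (intro mult_mono) auto
  have guxx: "\<bar>(\<gamma> - 1) * g x t * uxx x t\<bar> \<le> (\<gamma> - 1) * 1 * C"
    unfolding abs_mult using gam g C by (intro mult_mono) auto
  have mkx: "\<bar>\<mu> * kx x t\<bar> \<le> \<mu> * 1"
    unfolding abs_mult using mu kx by (intro mult_mono) auto
  have rukx: "\<bar>r x t * u x t * kx x t\<bar> \<le> C * C * 1"
    unfolding abs_mult using kx C by (intro mult_mono) auto
  have rkux: "\<bar>(\<gamma> - 1) * r x t * k x t * ux x t\<bar> \<le> (\<gamma> - 1) * C * 1 * C"
    unfolding abs_mult using gam k C by (intro mult_mono) auto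
  have Q: "Q x t \<le> b"
    using D gux mkx unfolding Q_def ab by linarith
  have "Qx x t = - (r x t * u x t * kx x t) - (r x t * kt x t + \<mu> * kxx x t)
      + (\<gamma> - 1) * r x t * k x t * ux x t - (\<gamma> - 1) * g x t * uxx x t"
    by (simp add: Qx_def algebra_simps)
  moreover have "C * C * 1 = C\<^sup>2" "(\<gamma> - 1) * C * 1 * C = (\<gamma> - 1) * C\<^sup>2"
    by (simp_all add: power2_eq_square)
  ultimately have Qx: "Qx x t \<le> - (2 * C * b)"
    using rukx rkux guxx large unfolding ab(1) by linarith
  have "Qx x t * g x t \<le> - (2 * C * b) * g x t"
    using Qx g by (intro mult_right_mono) auto
  also have "\<dots> \<le> - (2 * C * b) * (1 / 2)"
    using g b0 C by (intro mult_left_mono_neg) auto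
  finally have 1: "Qx x t * g x t \<le> - (C * b)" by simp
  have "Q x t * (r x t * k x t) \<le> b * (r x t * k x t)"
    using Q r0 k by (intro mult_right_mono) auto
  also have "\<dots> \<le> b * (C * 1)"
    using r0 k C b0 by (intro mult_left_mono mult_mono) auto
  finally show ?thesis using 1 by (simp add: Rx_def divide_nonpos_nonneg mult.commute)
qed

text \<open>Compactness and \<open>g > 0\<close> supply the coefficient bounds for
  \<open>nonlocal_hopf\<close>; its linear decay at time \<open>\<tau>\<close> clashes with the zero
  slope of \<open>Z\<close> at \<open>x = 0\<close>, which comes from \<open>F_bdry\<close>.\<close>

lemma initially_inward_contradiction:
  assumes c: "0 < c" "c < 1" and \<tau>: "0 < \<tau>" "\<tau> \<le> T"
    and g: "\<And>x t. x \<in> {0..1} \<Longrightarrow> t \<in> {0..\<tau>} \<Longrightarrow> g x t > 0"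
    and Rx: "\<And>x t. x \<in> {0..c} \<Longrightarrow> t \<in> {0..\<tau>} \<Longrightarrow> Rx x t \<le> 0"
    and Z0: "\<And>x. x \<in> {0..c} \<Longrightarrow> Z x 0 \<le> 0"
    and Zc: "\<And>t. t \<in> {0..\<tau>} \<Longrightarrow> Z c t < 0"
  shows False
proof -
  note m = cts_mono[OF _ \<tau>(2)]
  have g_nz: "\<forall>z\<in>{0..1} \<times> {0..\<tau>}. g (fst z) (snd z) \<noteq> 0" using g by force
  have \<beta>: "cts \<tau> (\<lambda>x t. u x t - 2 * \<mu> * k x t / g x t)"
    by (intro continuous_intros m[OF uD(1)] m[OF kD(1)] m[OF cts_flow(5)] g_nz)
  have R: "cts \<tau> (\<lambda>x t. Q x t / g x t)"
    by (intro continuous_intros m[OF cts_flow(11)] m[OF cts_flow(5)] g_nz)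
  have S: "cts \<tau> Rx" unfolding Rx_def
    by (intro continuous_intros m[OF cts_flow(11)] m[OF cts_flow(12)] m[OF cts_flow(5)] m[OF rD(1)] m[OF kD(1)])
      (use g_nz in auto)
  obtain B1 where B1: "B1 > 0" "\<And>x t. x \<in> {0..1} \<Longrightarrow> t \<in> {0..\<tau>} \<Longrightarrow> \<bar>r x t\<bar> \<le> B1"
    using cts_bounded[OF m[OF rD(1)]] by blast
  obtain B2 where B2: "B2 > 0"
    "\<And>x t. x \<in> {0..1} \<Longrightarrow> t \<in> {0..\<tau>} \<Longrightarrow> \<bar>u x t - 2 * \<mu> * k x t / g x t\<bar> \<le> B2"
    using cts_bounded[OF \<beta>] by blast
  obtain B3 where B3: "B3 > 0" "\<And>x t. x \<in> {0..1} \<Longrightarrow> t \<in> {0..\<tau>} \<Longrightarrow> \<bar>Q x t / g x t\<bar> \<le> B3"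
    using cts_bounded[OF R] by blast
  obtain B4 where B4: "B4 > 0" "\<And>x t. x \<in> {0..1} \<Longrightarrow> t \<in> {0..\<tau>} \<Longrightarrow> \<bar>Rx x t\<bar> \<le> B4"
    using cts_bounded[OF S] by blast
  note B = B1(1) B2(1) B3(1) B4(1)
  define C where "C = B1 + B2 + B3 + B4"
  have sub: "x \<in> {0..1}" if "x \<in> {0..c}" for x using that c by auto
  have at: "at x within {0..1} = at x" if "0 < x" "x < c" for x :: real
    using that c by (simp add: at_within_Icc_at)
  have "\<exists>\<epsilon>>0. \<forall>x\<in>{0..c}. Z x \<tau> \<le> - \<epsilon> * x"
  proof (rule nonlocal_hopf[where \<mu> = \<mu> and \<rho> = r and C = C and \<beta> = "\<lambda>x t. u x t - 2 * \<mu> * k x t / g x t"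
        and R = "\<lambda>x t. Q x t / g x t" and S = Rx and Zx = "\<lambda>x t. g x t * F x t" and Zxx = Zxx and Zt = Zt])
    show "continuous_on ({0..c} \<times> {0..\<tau>}) (\<lambda>z. Z (fst z) (snd z))"
      by (rule continuous_on_subset[OF m[OF cts_flow(10)]]) (use c in auto)
  next
    fix x t assume a: "0 < x" "x < c" "0 < t" "t \<le> \<tau>"
    then have x: "x \<in> {0..1}" and t: "t \<in> {0..T}" using c \<tau> by auto
    show "((\<lambda>y. Z y t) has_real_derivative g x t * F x t) (at x)"
      using Z_deriv_x[OF x t] at a by simp
    show "((\<lambda>y. g y t * F y t) has_real_derivative Zxx x t) (at x)"
      using Z_deriv_xx[OF x t] at a by simp
    show "((\<lambda>s. Z x s) has_real_derivative Zt x t) (at t within {0..\<tau>})"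
      using DERIV_subset[OF Z_deriv_t[OF x t], of "{0..\<tau>}"] \<tau> by simp
    show "\<mu> * Zxx x t = r x t * (Zt x t + (u x t - 2 * \<mu> * k x t / g x t) * (g x t * F x t)
      - Q x t / g x t * Z x t + integral {0..x} (\<lambda>y. Rx y t * Z y t))"
      by (rule Z_equation[OF x t g]) (use a in auto)
  next
    fix x t assume x: "x \<in> {0..c}" and t: "t \<in> {0..\<tau>}"
    show "0 \<le> r x t \<and> r x t \<le> C"
      using B1(2)[OF sub[OF x] t] B density_nonneg[of x t] sub[OF x] t \<tau> by (auto simp: C_def)
    show "\<bar>u x t - 2 * \<mu> * k x t / g x t\<bar> \<le> C \<and> \<bar>Q x t / g x t\<bar> \<le> C"
      using B2(2)[OF sub[OF x] t] B3(2)[OF sub[OF x] t] B unfolding C_def by linarith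
    show "- C \<le> Rx x t \<and> Rx x t \<le> 0"
      using B4(2)[OF sub[OF x] t] B Rx[OF x t] unfolding C_def by linarith
  next
    show "continuous_on {0..c} (\<lambda>x. Rx x t)" if "t \<in> {0..\<tau>}" for t
      by (rule continuous_on_subset[OF cts_slice_x[OF S that]]) (use c in auto)
    show "Z 0 t = 0" if "t \<in> {0..\<tau>}" for t
      using that \<tau> u_bdry by (simp add: Z_def)
  qed (use c \<tau> mu Z0 Zc in auto)
  then obtain \<epsilon> where "\<epsilon> > 0" "\<And>x. x \<in> {0..c} \<Longrightarrow> Z x \<tau> \<le> - \<epsilon> * x" by blast
  moreover have "((\<lambda>x. Z x \<tau>) has_real_derivative 0) (at 0 within {0..1})"
    using Z_deriv_x[of 0 \<tau>] F_bdry[of \<tau>] \<tau> by simp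
  moreover have "Z 0 \<tau> = 0" using \<tau> u_bdry by (simp add: Z_def)
  ultimately show False using c by (intro has_small_slope_contradiction[of "\<lambda>x. Z x \<tau>" c \<epsilon>]) auto
qed

end

section \<open>Non-existence\<close>

context vacuum_flow
begin

text \<open>The task is to construct \<open>k\<close>. The constants are fixed in the order
  \<open>C\<close>, \<open>\<theta>\<close>, \<open>K\<close>, \<open>N\<close>, \<open>m\<close>,
  \<open>M\<close>, \<open>\<tau>\<close>, each depending on earlier choices only: \<open>N\<close>
  fixes a layer \<open>[0, 1 / N]\<close> next to the vacuum, \<open>m\<close> bounds the density on
  the rest of \<open>[0, c]\<close>, and the time is shortened last to keep \<open>M * t\<close>
  small.\<close>

lemma left_contradiction:
  assumes c: "0 < c" "c < 1"
    and r0: "\<And>x. x \<in> {0<..<1} \<Longrightarrow> r x 0 > 0" and e0: "\<And>x. x \<in> {0<..<1} \<Longrightarrow> e x 0 \<ge> 0"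
    and u0: "\<And>x. x \<in> {0<..<c} \<Longrightarrow> u x 0 \<le> 0" and uc: "u c 0 < 0"
  shows False
proof -
  note rD = C21D[OF r_C21] and uD = C21D[OF u_C21]
  obtain B1 where B1: "B1 > 0" "\<And>x t. x \<in> {0..1} \<Longrightarrow> t \<in> {0..T} \<Longrightarrow> \<bar>r x t\<bar> \<le> B1"
    using cts_bounded[OF rD(1)] by blast
  obtain B2 where B2: "B2 > 0" "\<And>x t. x \<in> {0..1} \<Longrightarrow> t \<in> {0..T} \<Longrightarrow> \<bar>u x t\<bar> \<le> B2"
    using cts_bounded[OF uD(1)] by blast
  obtain B3 where B3: "B3 > 0" "\<And>x t. x \<in> {0..1} \<Longrightarrow> t \<in> {0..T} \<Longrightarrow> \<bar>ux x t\<bar> \<le> B3"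
    using cts_bounded[OF uD(2)] by blast
  obtain B4 where B4: "B4 > 0" "\<And>x t. x \<in> {0..1} \<Longrightarrow> t \<in> {0..T} \<Longrightarrow> \<bar>uxx x t\<bar> \<le> B4"
    using cts_bounded[OF uD(3)] by blast
  define C where "C = 1 + B1 + B2 + B3 + B4"
  have bounds: "\<bar>r x t\<bar> \<le> C" "\<bar>u x t\<bar> \<le> C" "\<bar>ux x t\<bar> \<le> C" "\<bar>uxx x t\<bar> \<le> C"
    if "x \<in> {0..1}" "t \<in> {0..T}" for x t
    using B1(1) B1(2)[OF that] B2(1) B2(2)[OF that] B3(1) B3(2)[OF that] B4(1) B4(2)[OF that]
    unfolding C_def by linarith+
  have C: "C \<ge> 1" using B1(1) B2(1) B3(1) B4(1) by (simp add: C_def)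
  \<comment> \<open>With \<open>k \<le> \<theta>\<close> this gives
    \<open>r * k \<le> 1 / 2\<close>, hence \<open>g \<ge> 1 / 2\<close>.\<close>
  define \<theta> where "\<theta> = 1 / (2 * C)"
  have \<theta>: "0 < \<theta>" "\<theta> \<le> 1" "C * \<theta> = 1 / 2" using C by (auto simp: \<theta>_def field_simps)
  define a b where "a = C\<^sup>2 + (\<gamma> - 1) * C\<^sup>2 + (\<gamma> - 1) * C" and "b = C\<^sup>2 + (\<gamma> - 1) * C + \<mu>"
  \<comment> \<open>The threshold that \<open>Rx_nonpos\<close> demands of
    \<open>r * kt + \<mu> * kxx\<close>.\<close>
  define K where "K = a + 2 * C * b"
  have K: "K > 0"
    unfolding K_def a_def b_def using C gam mu
    by (intro add_pos_pos mult_pos_pos) auto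
  \<comment> \<open>The summand \<open>1 / c\<close> places the layer inside \<open>[0, c]\<close>.
    The last one makes \<open>\<mu> * kxx\<close> at least \<open>K\<close> in the layer, where 6 is
    the 2 in \<open>kxx\<close> times the 3 of \<open>exp (- 1) \<ge> 1 / 3\<close>.\<close>
  define N where "N = 1 + 1 / c + 6 * K / (\<mu> * \<theta>)"
  have N1: "N \<ge> 1" and Nc: "1 / N \<le> c" and NK: "\<mu> * (\<theta> * N / 6) \<ge> K"
  proof -
    have "6 * K / (\<mu> * \<theta>) > 0" using K mu \<theta> by simp
    then show N1: "N \<ge> 1" using c unfolding N_def by (smt (verit) divide_pos_pos)
    have "N \<ge> 1 / c" using \<open>6 * K / (\<mu> * \<theta>) > 0\<close> by (simp add: N_def)
    then show "1 / N \<le> c" using c N1 by (simp add: field_simps)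
    have "N \<ge> 6 * K / (\<mu> * \<theta>)" using c by (simp add: N_def)
    then show "\<mu> * (\<theta> * N / 6) \<ge> K" using mu \<theta> by (simp add: field_simps)
  qed
  obtain m \<tau>1 where m: "m > 0" and \<tau>1: "\<tau>1 > 0" "\<tau>1 \<le> T"
    and rm: "\<And>x t. x \<in> {1 / N..c} \<Longrightarrow> t \<in> {0..\<tau>1} \<Longrightarrow> r x t \<ge> m"
  proof -
    have "r x 0 > 0" if "x \<in> {1 / N..c}" for x
    proof (rule r0)
      have "0 < 1 / N" using N1 by simp
      also have "\<dots> \<le> x" using that by simp
      finally show "x \<in> {0<..<1}" using that c by auto
    qed
    then show thesis
      using pos_lower_bound_short_time[OF rD(1) _ Nc _ T] N1 c that by (auto simp: less_imp_le)
  qed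
  \<comment> \<open>Outside the layer this yields \<open>r * kt \<ge> m * M = K\<close>.\<close>
  define M where "M = K / m"
  have M: "M > 0" using K m by (simp add: M_def)
  \<comment> \<open>The exponential makes \<open>\<mu> * kxx\<close> large near the vacuum, \<open>M * t\<close> makes \<open>r * kt\<close> large away
    from it, while \<open>k\<close> and \<open>kx\<close> stay small for short times.\<close>
  define k kx kxx kt :: "real \<Rightarrow> real \<Rightarrow> real"
    where "k = (\<lambda>x t. \<theta> / (2 * N) * exp (- (N * x)) + M * t)"
      and "kx = (\<lambda>x t. - (\<theta> / 2) * exp (- (N * x)))"
      and "kxx = (\<lambda>x t. \<theta> * N / 2 * exp (- (N * x)))" and "kt = (\<lambda>x t. M)"
  have kC: "C21 T k kx kxx kt"
    unfolding C21_def case_prod_unfold k_def kx_def kxx_def kt_def using N1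
    by (auto intro!: continuous_intros derivative_eq_intros)
  interpret W: weighted_vacuum_flow \<mu> \<gamma> T r rx rxx rt u ux uxx ut e ex exx et k kx kxx kt
    by unfold_locales (rule kC)
  have expN: "0 < exp (- (N * x))" "exp (- (N * x)) \<le> 1" if "x \<in> {0..1}" for x
    using that N1 by auto
  have \<theta>N: "\<theta> / (2 * N) \<le> \<theta> / 2" using N1 \<theta> by (simp add: field_simps)
  have k_bounds: "0 \<le> k x t" "k x t \<le> \<theta>" if x: "x \<in> {0..1}" and t: "0 \<le> t" "M * t \<le> \<theta> / 2" for x t
  proof -
    show "0 \<le> k x t" unfolding k_def using N1 \<theta> M t by (intro add_nonneg_nonneg mult_nonneg_nonneg) auto
    have "\<theta> / (2 * N) * exp (- (N * x)) \<le> \<theta> / 2 * 1"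
      using \<theta>N expN[OF x] \<theta> by (intro mult_mono) auto
    then show "k x t \<le> \<theta>" using t by (simp add: k_def)
  qed
  have kx_bound: "\<bar>kx x t\<bar> \<le> \<theta>" if x: "x \<in> {0..1}" for x t
  proof -
    have "\<theta> / 2 * exp (- (N * x)) \<le> \<theta> / 2 * 1" using expN[OF x] \<theta> by (intro mult_left_mono) auto
    moreover have "\<bar>kx x t\<bar> = \<theta> / 2 * exp (- (N * x))" using \<theta> by (simp add: kx_def abs_mult)
    ultimately show ?thesis using \<theta> by linarith
  qed
  have g_bounds: "1 / 2 \<le> W.g x t" "W.g x t \<le> 1"
    if x: "x \<in> {0..1}" and t: "t \<in> {0..T}" "M * t \<le> \<theta> / 2" for x t
  proof -
    have "0 \<le> r y t * k y t \<and> r y t * k y t \<le> 1 / 2" if y: "y \<in> {0..1}" for y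
    proof -
      have kb: "0 \<le> k y t" "k y t \<le> \<theta>" using k_bounds[OF y _ t(2)] t(1) by auto
      have "r y t \<ge> 0" by (rule density_nonneg[OF y t(1)])
      moreover have "r y t * k y t \<le> C * \<theta>"
        using bounds(1)[OF y t(1)] kb C by (intro mult_mono) auto
      ultimately show ?thesis using kb \<theta>(3) by simp
    qed
    from W.g_bounds[OF x t(1) this] show "1 / 2 \<le> W.g x t" "W.g x t \<le> 1" by auto
  qed
  have Z_init: "W.Z x 0 \<le> \<mu> * W.g x 0 * u x 0" if x: "x \<in> {0..c}" for x
  proof (rule W.Z_init_le)
    fix y assume y: "y \<in> {0..x}"
    have "W.g y 0 \<ge> 1 / 2" by (rule g_bounds) (use x y c T \<theta> in auto)
    moreover have "k y 0 \<ge> 0" by (rule k_bounds) (use x y c \<theta> in auto)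
    moreover have "u y 0 \<le> 0"
      using u0[of y] uc u_bdry(1)[of 0] x y T by (cases "y = 0"; cases "y = c") auto
    \<comment> \<open>The sign of \<open>e\<close> is given only inside the interval; at
      \<open>y = 0\<close> the pressure vanishes with the density.\<close>
    moreover have "W.p y 0 \<ge> 0"
    proof (cases "y = 0")
      case False
      then show ?thesis
        using r0[of y] e0[of y] x y c gam by (simp add: W.p_def)
    qed (use r_bdry T in \<open>simp add: W.p_def\<close>)
    ultimately show "0 \<le> k y 0 \<and> 0 \<le> W.g y 0 \<and> u y 0 \<le> 0 \<and> 0 \<le> W.p y 0" by simp
  qed (use x c T in auto)
  have cin: "c \<in> {0..1}" "0 \<in> {0..T}" using c T by auto
  have Z0: "W.Z x 0 \<le> 0" if x: "x \<in> {0..c}" for x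
  proof -
    have "W.g x 0 \<ge> 1 / 2" by (rule g_bounds) (use x c T \<theta> in auto)
    moreover have "u x 0 \<le> 0"
      using u0[of x] uc u_bdry(1)[of 0] x T by (cases "x = 0"; cases "x = c") auto
    ultimately have "\<mu> * W.g x 0 * u x 0 \<le> 0" using mu by (intro mult_nonneg_nonpos) auto
    then show ?thesis using Z_init[OF x] by linarith
  qed
  have Zc0: "W.Z c 0 < 0"
  proof -
    have "W.g c 0 \<ge> 1 / 2" by (rule g_bounds) (use c T \<theta> in auto)
    then have "\<mu> * W.g c 0 * u c 0 < 0" using mu uc by (intro mult_pos_neg mult_pos_pos) auto
    then show ?thesis using Z_init[of c] c by auto
  qed
  obtain \<tau>2 where \<tau>2: "\<tau>2 > 0" "\<And>t. t \<in> {0..T} \<Longrightarrow> t < \<tau>2 \<Longrightarrow> W.Z c t < 0"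
  proof -
    have "continuous_on {0..T} (\<lambda>t. W.Z c t)" by (rule cts_slice_t[OF W.cts_flow(10) cin(1)])
    then obtain d where d: "d > 0" "\<And>t. t \<in> {0..T} \<Longrightarrow> dist t 0 < d \<Longrightarrow> dist (W.Z c t) (W.Z c 0) < - W.Z c 0"
      using Zc0 cin(2) unfolding continuous_on_iff by (metis neg_0_less_iff_less)
    have "W.Z c t < 0" if "t \<in> {0..T}" "t < d" for t
      using d(2)[of t] that by (auto simp: dist_real_def)
    then show thesis using d(1) that by blast
  qed
  \<comment> \<open>The three bounds preserve the lower bound \<open>m\<close>, the sign of
    \<open>Z\<close> at \<open>x = c\<close>, and \<open>M * t \<le> \<theta> / 2\<close>, which
    keeps \<open>k \<le> \<theta>\<close>.\<close>
  define \<tau> where "\<tau> = min \<tau>1 (min (\<tau>2 / 2) (\<theta> / (2 * M)))"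
  have \<tau>: "0 < \<tau>" "\<tau> \<le> T" "\<tau> \<le> \<tau>1" "\<tau> < \<tau>2" using \<tau>1 \<tau>2(1) \<theta> M by (auto simp: \<tau>_def)
  have M\<tau>: "M * t \<le> \<theta> / 2" if "t \<in> {0..\<tau>}" for t
  proof -
    have "t \<le> \<theta> / (2 * M)" using that by (simp add: \<tau>_def)
    then show ?thesis using M by (simp add: field_simps)
  qed
  show False
  proof (rule W.initially_inward_contradiction[OF c \<tau>(1,2) _ _ Z0])
    show "W.g x t > 0" if "x \<in> {0..1}" "t \<in> {0..\<tau>}" for x t
      using g_bounds(1)[OF that(1) _ M\<tau>[OF that(2)]] that \<tau> by auto
    show "W.Z c t < 0" if "t \<in> {0..\<tau>}" for t
      using \<tau>2(2)[of t] that \<tau> by auto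
    fix x t assume xc: "x \<in> {0..c}" and t\<tau>: "t \<in> {0..\<tau>}"
    have x: "x \<in> {0..1}" and t: "t \<in> {0..T}" using xc t\<tau> c \<tau> by auto
    note Mt = M\<tau>[OF t\<tau>]
    \<comment> \<open>The part \<open>r * kt\<close> of the integrand is nonnegative, so the
      possibly large \<open>M\<close> does no harm and only \<open>r * u * kx\<close> has to be
      estimated.\<close>
    have "- W.D x t \<le> C\<^sup>2"
    proof -
      have "- (C * C * 1) * x \<le> integral {0..x} (\<lambda>y. r y t * (u y t * kx y t + kt y t))"
      proof (rule integral_ge_const)
        show "continuous_on {0..x} (\<lambda>y. r y t * (u y t * kx y t + kt y t))"
          by (rule continuous_on_subset[of "{0..1}"])
            (use x in \<open>auto intro!: continuous_intros cts_slice_x[OF _ t] rD uD W.kD\<close>)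
        fix y assume "y \<in> {0..x}"
        then have y: "y \<in> {0..1}" using x by auto
        have "\<bar>kx y t\<bar> \<le> 1" using kx_bound[OF y] \<theta>(2) by (meson order_trans)
        then have "\<bar>r y t * u y t * kx y t\<bar> \<le> C * C * 1"
          unfolding abs_mult using bounds[OF y t] C by (intro mult_mono) auto
        moreover have "r y t * kt y t \<ge> 0"
          using density_nonneg[OF y t] M by (simp add: kt_def)
        ultimately show "- (C * C * 1) \<le> r y t * (u y t * kx y t + kt y t)"
          unfolding distrib_left abs_le_iff by (simp add: mult.assoc)
      qed (use x in auto)
      moreover have "C * C * 1 * x \<le> C * C * 1 * 1" using x C by (intro mult_left_mono) auto
      ultimately show ?thesis by (simp add: W.D_def power2_eq_square)
    qed
    moreover have "r x t * kt x t + \<mu> * kxx x t \<ge> K"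
    proof (cases "x \<le> 1 / N")
      case True
      have "exp (- (N * x)) \<ge> exp (- 1)" using True N1 by (simp add: field_simps)
      moreover have "exp (- 1) \<ge> (1 / 3 :: real)" using exp_le by (simp add: exp_minus field_simps)
      ultimately have "1 / 3 \<le> exp (- (N * x))" by linarith
      then have "\<theta> * N / 2 * exp (- (N * x)) \<ge> \<theta> * N / 2 * (1 / 3)"
        using \<theta> N1 by (intro mult_left_mono) auto
      then have "\<theta> * N / 6 \<le> kxx x t" by (simp add: kxx_def)
      then have "\<mu> * kxx x t \<ge> \<mu> * (\<theta> * N / 6)" using mu by (intro mult_left_mono) auto
      moreover have "r x t * kt x t \<ge> 0" using density_nonneg[OF x t] M by (simp add: kt_def)
      ultimately show ?thesis using NK by linarith
    next
      case False
      then have "r x t \<ge> m" using rm[of x t] xc t\<tau> \<tau> by auto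
      then have "r x t * kt x t \<ge> m * M" using M by (simp add: kt_def)
      moreover have "m * M = K" using m by (simp add: M_def)
      moreover have "\<mu> * kxx x t \<ge> 0" using mu \<theta> N1 by (simp add: kxx_def)
      ultimately show ?thesis by linarith
    qed
    moreover have "\<bar>kx x t\<bar> \<le> 1" using kx_bound[OF x] \<theta>(2) by (meson order_trans)
    moreover have "0 \<le> k x t" "k x t \<le> 1" using k_bounds[OF x _ Mt] t \<theta>(2) by auto
    ultimately show "W.Rx x t \<le> 0"
      using bounds[OF x t] C g_bounds[OF x t Mt] density_nonneg[OF x t]
      by (intro W.Rx_nonpos[where C = C and a = a and b = b]) (auto simp: K_def a_def b_def)
  qed
qed

end

section \<open>Passage from the stated problem to the closed rectangle, and reflection\<close>

lemma vacuum_flow_contradiction: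
  fixes \<mu> \<gamma> T c :: real
  assumes pos: "\<mu> > 0" "\<gamma> > 1" "T > 0"
    and r: "C21 T \<rho> \<rho>x \<rho>xx \<rho>t" and u: "C21 T u ux uxx ut" and e: "C21 T e ex exx et"
    and mass: "\<And>x t. x \<in> {0<..<1} \<Longrightarrow> t \<in> {0<..T} \<Longrightarrow>
      \<rho>t x t + (\<rho>x x t * u x t + \<rho> x t * ux x t) = 0"
    and momentum: "\<And>x t. x \<in> {0<..<1} \<Longrightarrow> t \<in> {0<..T} \<Longrightarrow>
      (\<rho>t x t * u x t + \<rho> x t * ut x t)
        + (\<rho>x x t * (u x t)\<^sup>2 + 2 * \<rho> x t * u x t * ux x t
           + (\<gamma> - 1) * (\<rho>x x t * e x t + \<rho> x t * ex x t)) = \<mu> * uxx x t"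
    and energy: "\<And>x t. x \<in> {0<..<1} \<Longrightarrow> t \<in> {0<..T} \<Longrightarrow>
      (\<rho>t x t * e x t + \<rho> x t * et x t)
        + (\<rho>x x t * e x t * u x t + \<rho> x t * ex x t * u x t + \<rho> x t * e x t * ux x t)
        + (\<gamma> - 1) * \<rho> x t * e x t * ux x t = \<mu> * (ux x t)\<^sup>2"
    and bdry: "\<And>x t. x \<in> {0, 1} \<Longrightarrow> t \<in> {0<..T} \<Longrightarrow> \<rho> x t = 0 \<and> u x t = 0 \<and> ux x t = 0"
    and c: "0 < c" "c < 1"
    and r0: "\<And>x. x \<in> {0<..<1} \<Longrightarrow> \<rho> x 0 > 0" and e0: "\<And>x. x \<in> {0<..<1} \<Longrightarrow> e x 0 \<ge> 0"
    and u0: "\<And>x. x \<in> {0<..<c} \<Longrightarrow> u x 0 \<le> 0" and uc: "u c 0 < 0"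
  shows False
proof -
  note rD = C21D[OF r] and uD = C21D[OF u] and eD = C21D[OF e]
  note closure = zero_on_closure[OF pos(3)]
  have bdry0: "f x t = 0"
    if f: "cts T f" and x: "x \<in> {0, 1}" and zero: "\<And>t. t \<in> {0<..T} \<Longrightarrow> f x t = 0" and t: "t \<in> {0..T}"
    for f x t
  proof -
    \<comment> \<open>Regarded as a function on the rectangle that is constant in its first
      argument, the boundary trace falls under \<open>zero_on_closure\<close>, which adds
      \<open>t = 0\<close>.\<close>
    have "cts T (\<lambda>y s. f x s)"
      by (rule continuous_on_compose2[OF f, of _ "\<lambda>z. (x, snd z)", simplified])
        (use x in \<open>auto intro!: continuous_intros\<close>)
    from closure[OF this zero, of 0 t] t show ?thesis by auto
  qed
  have b: "\<rho> x t = 0" "u x t = 0" "ux x t = 0" if "x \<in> {0, 1}" "t \<in> {0..T}" for x t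
    by (rule bdry0[OF _ that(1) _ that(2)]; use bdry that rD uD in blast)+
  interpret vacuum_flow \<mu> \<gamma> T \<rho> \<rho>x \<rho>xx \<rho>t u ux uxx ut e ex exx et
  proof
    fix x t :: real assume xt: "x \<in> {0..1}" "t \<in> {0..T}"
    have "\<rho>t x t + (\<rho>x x t * u x t + \<rho> x t * ux x t) = 0"
      by (rule closure[OF _ mass xt]) (intro continuous_intros rD uD)
    then show "\<rho>t x t = - (\<rho>x x t * u x t + \<rho> x t * ux x t)" by simp
    have "\<rho> x t * (ut x t + u x t * ux x t)
        - (\<mu> * uxx x t - (\<gamma> - 1) * (\<rho>x x t * e x t + \<rho> x t * ex x t)) = 0"
    proof (rule closure[OF _ _ xt])
      fix x t :: real assume xt: "x \<in> {0<..<1}" "t \<in> {0<..T}"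
      \<comment> \<open>Eliminating \<open>\<rho>t\<close> removes \<open>u\<close> times the mass
        equation from the momentum equation.\<close>
      have "\<rho>t x t = - (\<rho>x x t * u x t + \<rho> x t * ux x t)" using mass[OF xt] by simp
      with momentum[OF xt] show "\<rho> x t * (ut x t + u x t * ux x t)
        - (\<mu> * uxx x t - (\<gamma> - 1) * (\<rho>x x t * e x t + \<rho> x t * ex x t)) = 0"
        by (simp add: algebra_simps power2_eq_square)
    qed (intro continuous_intros rD uD eD)
    then show "\<rho> x t * (ut x t + u x t * ux x t)
        = \<mu> * uxx x t - (\<gamma> - 1) * (\<rho>x x t * e x t + \<rho> x t * ex x t)" by simp
    have "(\<rho>t x t * e x t + \<rho> x t * et x t) + u x t * (\<rho>x x t * e x t + \<rho> x t * ex x t)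
        + \<gamma> * \<rho> x t * e x t * ux x t - \<mu> * (ux x t)\<^sup>2 = 0"
    proof (rule closure[OF _ _ xt])
      fix x t :: real assume xt: "x \<in> {0<..<1}" "t \<in> {0<..T}"
      show "(\<rho>t x t * e x t + \<rho> x t * et x t) + u x t * (\<rho>x x t * e x t + \<rho> x t * ex x t)
        + \<gamma> * \<rho> x t * e x t * ux x t - \<mu> * (ux x t)\<^sup>2 = 0"
        unfolding energy[OF xt, symmetric] by (simp add: algebra_simps)
    qed (intro continuous_intros rD uD eD)
    then show "(\<rho>t x t * e x t + \<rho> x t * et x t) + u x t * (\<rho>x x t * e x t + \<rho> x t * ex x t)
        + \<gamma> * \<rho> x t * e x t * ux x t = \<mu> * (ux x t)\<^sup>2" by simp
  next
    fix x :: real assume "x \<in> {0..1}"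
    then show "\<rho> x 0 \<ge> 0" using r0[of x] b(1)[of x 0] pos(3) by (cases "x \<in> {0, 1}") auto
  qed (use pos r u e b in auto)
  show False by (rule left_contradiction[where c = c]) (use c r0 e0 u0 uc in auto)
qed

text \<open>Under \<open>x \<mapsto> 1 - x\<close> the first \<open>x\<close>-derivative changes
  sign and the second does not; with \<open>u\<close> negated as well, the equations keep their
  form.\<close>

lemma C21_reflect:
  assumes "C21 T f fx fxx ft"
  shows "C21 T (\<lambda>x. f (1 - x)) (\<lambda>x t. - fx (1 - x) t) (\<lambda>x. fxx (1 - x)) (\<lambda>x. ft (1 - x))"
proof -
  note f = C21D[OF assms]
  have cts: "cts T (\<lambda>x. q (1 - x))" if "cts T q" for q
    by (rule continuous_on_compose2[OF that, of _ "\<lambda>z. (1 - fst z, snd z)", simplified])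
      (auto intro!: continuous_intros)
  have D: "((\<lambda>y. q (1 - y) t) has_real_derivative - d) (at x within {0..1})"
    if "((\<lambda>y. q y t) has_real_derivative d) (at (1 - x) within {0..1})" for q :: "real \<Rightarrow> real \<Rightarrow> real" and d x t
  proof -
    have "(\<lambda>y. 1 - y) ` {0..1} = {0..1::real}" by (auto simp: image_iff intro: bexI[of _ "1 - _"])
    then have "((\<lambda>y. q y t) \<circ> (\<lambda>y. 1 - y) has_real_derivative d * (- 1)) (at x within {0..1})"
      by (intro DERIV_image_chain) (use that in \<open>auto intro!: derivative_eq_intros\<close>)
    then show ?thesis by (simp add: o_def)
  qed
  have "((\<lambda>y. - fx (1 - y) t) has_real_derivative fxx (1 - x) t) (at x within {0..1})"
    if "x \<in> {0..1}" "t \<in> {0..T}" for x t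
    using DERIV_minus[OF D[where q = fx, OF f(6)[of "1 - x" t]]] that by auto
  then show ?thesis
    unfolding C21_def case_prod_unfold using f D
    by (auto intro!: cts continuous_intros)
qed

lemma C21_uminus:
  assumes "C21 T f fx fxx ft"
  shows "C21 T (\<lambda>x t. - f x t) (\<lambda>x t. - fx x t) (\<lambda>x t. - fxx x t) (\<lambda>x t. - ft x t)"
  using C21D[OF assms] unfolding C21_def case_prod_unfold
  by (auto intro!: continuous_intros DERIV_minus)

theorem theorem3p1:
  fixes \<mu> \<gamma> :: real and \<rho>0 u0 e0 :: "real \<Rightarrow> real"
    and lam5 lam6 lam7 lam8 :: real
  assumes mu: "\<mu> > 0" and gam: "\<gamma> > 1"
    and rho0_cont: "continuous_on {0..1} \<rho>0"
    and rho0_pos: "\<forall>x\<in>{0<..<1}. \<rho>0 x > 0"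
    and rho0_bd: "\<rho>0 0 = 0" "\<rho>0 1 = 0"
    and u0_cont: "continuous_on {0..1} u0"
    and e0_cont: "continuous_on {0..1} e0"
    and e0_nonneg: "\<forall>x\<in>{0<..<1}. e0 x \<ge> 0"
    and e0_nonzero: "\<exists>x\<in>{0<..<1}. e0 x \<noteq> 0"
    and lam: "lam5 > 0" "lam6 > 0" "0 < lam7" "lam7 < 1" "0 < lam8" "lam8 < 1"
    and alt:
      "(\<forall>x\<in>{0<..<lam7}. \<rho>0 differentiable (at x) \<and> e0 differentiable (at x) \<and>
            deriv \<rho>0 x / \<rho>0 x + deriv e0 x / \<rho>0 x \<ge> lam5)
         \<and> u0 lam7 < 0 \<and> (\<forall>x\<in>{0<..<lam7}. u0 x \<le> 0)
       \<or>
       (\<forall>x\<in>{lam8<..<1}. \<rho>0 differentiable (at x) \<and> e0 differentiable (at x) \<and>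
            deriv \<rho>0 x / \<rho>0 x + deriv e0 x / \<rho>0 x \<le> - lam6)
         \<and> u0 lam8 > 0 \<and> (\<forall>x\<in>{lam8<..<1}. u0 x \<ge> 0)"
    and T: "T > 0"
  shows "\<not> (\<exists>\<rho> \<rho>x \<rho>xx \<rho>t u ux uxx ut e ex exx et.
     C21 T \<rho> \<rho>x \<rho>xx \<rho>t \<and> C21 T u ux uxx ut \<and> C21 T e ex exx et \<and>
     (\<forall>x\<in>{0<..<1}. \<forall>t\<in>{0<..T}.
        \<rho>t x t + (\<rho>x x t * u x t + \<rho> x t * ux x t) = 0 \<and>
        (\<rho>t x t * u x t + \<rho> x t * ut x t)
          + (\<rho>x x t * (u x t)\<^sup>2 + 2 * \<rho> x t * u x t * ux x t
             + (\<gamma> - 1) * (\<rho>x x t * e x t + \<rho> x t * ex x t))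
          = \<mu> * uxx x t \<and>
        (\<rho>t x t * e x t + \<rho> x t * et x t)
          + (\<rho>x x t * e x t * u x t + \<rho> x t * ex x t * u x t + \<rho> x t * e x t * ux x t)
          + (\<gamma> - 1) * \<rho> x t * e x t * ux x t
          = \<mu> * (ux x t)\<^sup>2) \<and>
     (\<forall>x\<in>{0<..<1}. \<rho> x 0 = \<rho>0 x \<and> u x 0 = u0 x \<and> e x 0 = e0 x) \<and>
     (\<forall>x\<in>{0,1}. \<forall>t\<in>{0<..T}. \<rho> x t = 0 \<and> u x t = 0 \<and> ux x t = 0))"
proof (rule notI, elim exE conjE)
  fix \<rho> \<rho>x \<rho>xx \<rho>t u ux uxx ut e ex exx et
  assume C: "C21 T \<rho> \<rho>x \<rho>xx \<rho>t" "C21 T u ux uxx ut" "C21 T e ex exx et"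
    and pde: "\<forall>x\<in>{0<..<1}. \<forall>t\<in>{0<..T}.
        \<rho>t x t + (\<rho>x x t * u x t + \<rho> x t * ux x t) = 0 \<and>
        (\<rho>t x t * u x t + \<rho> x t * ut x t)
          + (\<rho>x x t * (u x t)\<^sup>2 + 2 * \<rho> x t * u x t * ux x t
             + (\<gamma> - 1) * (\<rho>x x t * e x t + \<rho> x t * ex x t))
          = \<mu> * uxx x t \<and>
        (\<rho>t x t * e x t + \<rho> x t * et x t)
          + (\<rho>x x t * e x t * u x t + \<rho> x t * ex x t * u x t + \<rho> x t * e x t * ux x t)
          + (\<gamma> - 1) * \<rho> x t * e x t * ux x t
          = \<mu> * (ux x t)\<^sup>2"
    and init: "\<forall>x\<in>{0<..<1}. \<rho> x 0 = \<rho>0 x \<and> u x 0 = u0 x \<and> e x 0 = e0 x"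
    and bdry: "\<forall>x\<in>{0,1}. \<forall>t\<in>{0<..T}. \<rho> x t = 0 \<and> u x t = 0 \<and> ux x t = 0"
  note mass = pde[rule_format, THEN conjunct1]
    and momentum = pde[rule_format, THEN conjunct2, THEN conjunct1]
    and energy = pde[rule_format, THEN conjunct2, THEN conjunct2]
  note init = init[rule_format] and bdry = bdry[rule_format]
  have r0: "\<rho> x 0 > 0" and e0: "e x 0 \<ge> 0" if "x \<in> {0<..<1}" for x
    using init[OF that] rho0_pos e0_nonneg that by auto
  from alt show False
  proof (elim disjE conjE)
    assume "u0 lam7 < 0" "\<forall>x\<in>{0<..<lam7}. u0 x \<le> 0"
    then show False
      using init lam
      by (intro vacuum_flow_contradiction[OF mu gam T C mass momentum energy bdry lam(3,4) r0 e0]) auto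
  next
    assume sgn: "u0 lam8 > 0" "\<forall>x\<in>{lam8<..<1}. u0 x \<ge> 0"
    show False
    \<comment> \<open>Reflecting \<open>x\<close> and negating the velocity carries the right end
      point to the left one: \<open>u \<ge> 0\<close> near 1 becomes \<open>u \<le> 0\<close> near
      0, and \<open>lam8\<close> becomes \<open>1 - lam8\<close>.\<close>
    proof (rule vacuum_flow_contradiction[OF mu gam T C21_reflect[OF C(1)] C21_uminus[OF C21_reflect[OF C(2)]]
          C21_reflect[OF C(3)], where c = "1 - lam8"])
      fix x t :: real assume "x \<in> {0<..<1}" "t \<in> {0<..T}"
      then have xt: "1 - x \<in> {0<..<1}" "t \<in> {0<..T}" by auto
      show "\<rho>t (1 - x) t + (- \<rho>x (1 - x) t * - u (1 - x) t + \<rho> (1 - x) t * - (- ux (1 - x) t)) = 0"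
        using mass[OF xt] by simp
      show "(\<rho>t (1 - x) t * - u (1 - x) t + \<rho> (1 - x) t * - ut (1 - x) t)
          + (- \<rho>x (1 - x) t * (- u (1 - x) t)\<^sup>2 + 2 * \<rho> (1 - x) t * - u (1 - x) t * - (- ux (1 - x) t)
             + (\<gamma> - 1) * (- \<rho>x (1 - x) t * e (1 - x) t + \<rho> (1 - x) t * - ex (1 - x) t))
          = \<mu> * - uxx (1 - x) t"
        using momentum[OF xt] by (simp add: algebra_simps)
      show "(\<rho>t (1 - x) t * e (1 - x) t + \<rho> (1 - x) t * et (1 - x) t)
          + (- \<rho>x (1 - x) t * e (1 - x) t * - u (1 - x) t + \<rho> (1 - x) t * - ex (1 - x) t * - u (1 - x) t
             + \<rho> (1 - x) t * e (1 - x) t * - (- ux (1 - x) t))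
          + (\<gamma> - 1) * \<rho> (1 - x) t * e (1 - x) t * - (- ux (1 - x) t) = \<mu> * (- (- ux (1 - x) t))\<^sup>2"
        using energy[OF xt] by simp
    next
      fix x t :: real assume "x \<in> {0, 1}" "t \<in> {0<..T}"
      then show "\<rho> (1 - x) t = 0 \<and> - u (1 - x) t = 0 \<and> - (- ux (1 - x) t) = 0"
        using bdry[of "1 - x" t] by auto
    next
      fix x assume "x \<in> {0<..<1 - lam8}"
      then show "- u (1 - x) 0 \<le> 0" using init[of "1 - x"] sgn lam by auto
    next
      show "- u (1 - (1 - lam8)) 0 < 0" using init[of lam8] sgn lam by auto
    qed (use r0 e0 lam in auto)
  qed
qed

end
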